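(* For any fixed positive real $\epsilon>0$ there exists a polynomial-time algorithm which, when $f_1,\dots,f_n$ are (not necessarily monotone) submodular and $\mathcal{I}=2^E$, outputs $p\in\Delta(2^E)$ with $\min_{k\in[n]}\sum_{X\subseteq E}p_Xf_k(X)\ge(1/2-\epsilon)\nu^*$.
   Context: $E$ finite, $f_1,\dots,f_n\colon2^E\to\mathbb{R}_{\ge0}$ submodular with $f_k(\emptyset)=0$, given by value oracles. $\Delta(2^E)$ is the set of probability distributions over subsets of $E$ and $\nu^*=\max_{p\in\Delta(2^E)}\min_k\sum_Xp_Xf_k(X)$. *)

theory Defs
  imports "HOL-Probability.Probability" "HOL-Computational_Algebra.Polynomial"
begin

section \<open>Robust submodular maximization\<close>

definition submodular_on :: "'a set \<Rightarrow> ('a set \<Rightarrow> real) \<Rightarrow> bool" where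
  "submodular_on E f \<longleftrightarrow>
     (\<forall>X Y. X \<subseteq> E \<longrightarrow> Y \<subseteq> E \<longrightarrow> f (X \<union> Y) + f (X \<inter> Y) \<le> f X + f Y)"

definition Delta :: "'a set set \<Rightarrow> 'a set pmf set" where
  "Delta I = {p. set_pmf p \<subseteq> I}"

text \<open>The functions are indexed by \<open>1, \<dots>, n\<close>; their values outside \<open>I\<close> and at other indices are
  irrelevant.\<close>

definition robust_value :: "'a set set \<Rightarrow> nat \<Rightarrow> (nat \<Rightarrow> 'a set \<Rightarrow> real) \<Rightarrow> 'a set pmf \<Rightarrow> real" where
  "robust_value I n f p = (MIN k\<in>{1..n}. \<Sum>X\<in>I. pmf p X * f k X)"

definition nu_star :: "'a set set \<Rightarrow> nat \<Rightarrow> (nat \<Rightarrow> 'a set \<Rightarrow> real) \<Rightarrow> real" where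
  "nu_star I n f = (SUP p\<in>Delta I. robust_value I n f p)"

text \<open>The supremum is a maximum.\<close>

lemma nu_star_attained:
  fixes f :: "nat \<Rightarrow> 'a set \<Rightarrow> real"
  assumes I: "finite I" "I \<noteq> {}" and n: "n \<ge> 1"
  shows "\<exists>p\<in>Delta I. robust_value I n f p = nu_star I n f
           \<and> (\<forall>q\<in>Delta I. robust_value I n f q \<le> nu_star I n f)"
proof -
  define K where "K = {p :: 'a set \<Rightarrow> real. (\<forall>X. 0 \<le> p X) \<and> (\<forall>X. X \<notin> I \<longrightarrow> p X = 0) \<and> sum p I = 1}"
  define B where "B = PiE UNIV (\<lambda>X. if X \<in> I then {0..1::real} else {0})"
  define g where "g = (\<lambda>p :: 'a set \<Rightarrow> real. MIN k\<in>{1..n}. \<Sum>X\<in>I. p X * f k X)"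
  have "compactin (product_topology (\<lambda>_. euclidean) UNIV) B"
    unfolding B_def compactin_PiE by auto
  then have cB: "compact B"
    by (simp add: euclidean_product_topology)
  have "K = B \<inter> {p. sum p I = 1}"
  proof (intro set_eqI iffI)
    fix p assume p: "p \<in> K"
    have "p X \<le> 1" if "X \<in> I" for X
      using p that member_le_sum[of X I p] I by (auto simp: K_def)
    then show "p \<in> B \<inter> {p. sum p I = 1}"
      using p by (auto simp: K_def B_def PiE_def Pi_def)
  next
    fix p assume p: "p \<in> B \<inter> {p. sum p I = 1}"
    have B: "p X \<in> (if X \<in> I then {0..1} else {0})" for X
      using p by (simp add: B_def PiE_def Pi_def)
    have "0 \<le> p X" for X using B[of X] by (cases "X \<in> I") auto
    moreover have "p X = 0" if "X \<notin> I" for X using B[of X] that by auto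
    ultimately show "p \<in> K"
      using p by (simp add: K_def)
  qed
  moreover have "closed {p :: 'a set \<Rightarrow> real. sum p I = 1}"
    by (intro closed_Collect_eq continuous_intros continuous_on_product_coordinates)
  ultimately have cK: "compact K"
    using cB by (simp add: compact_Int_closed)
  have "continuous_on K (\<lambda>p. Min ((\<lambda>k. \<Sum>X\<in>I. p X * f k X) ` A))"
    if "finite A" "A \<noteq> {}" for A :: "nat set"
    using that
  proof (induction A rule: finite_ne_induct)
    case (singleton k)
    have "continuous_on K (\<lambda>p. \<Sum>X\<in>I. p X * f k X)"
      by (intro continuous_intros continuous_on_subset[OF continuous_on_product_coordinates]) auto
    then show ?case by simp
  next
    case (insert k A)
    have "continuous_on K (\<lambda>p. \<Sum>X\<in>I. p X * f k X)"
      by (intro continuous_intros continuous_on_subset[OF continuous_on_product_coordinates]) auto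
    then show ?case using insert by (simp add: continuous_on_min)
  qed
  then have cg: "continuous_on K g"
    using n by (simp add: g_def)
  have D: "pmf p \<in> K" if "p \<in> Delta I" for p
    using that I by (auto simp: K_def Delta_def sum_pmf_eq_1 pmf_eq_0_set_pmf)
  obtain X0 where "X0 \<in> I" using I by auto
  then have "return_pmf X0 \<in> Delta I" by (simp add: Delta_def)
  then have "K \<noteq> {}" using D by blast
  then obtain p where p: "p \<in> K" "\<forall>q\<in>K. g q \<le> g p"
    using continuous_attains_sup[OF cK _ cg] by blast
  have "(\<integral>\<^sup>+ X. ennreal (p X) \<partial>count_space UNIV) = (\<Sum>X\<in>I. ennreal (p X))"
    using p I by (intro nn_integral_count_space') (auto simp: K_def)
  also have "\<dots> = 1"
    using p by (simp add: K_def sum_ennreal)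
  finally have e: "pmf (embed_pmf p) = p"
    using p by (intro ext pmf_embed_pmf) (auto simp: K_def)
  have mem: "embed_pmf p \<in> Delta I"
    using p e by (auto simp: Delta_def set_pmf_eq K_def)
  have rv: "robust_value I n f q = g (pmf q)" for q
    by (simp add: robust_value_def g_def)
  have max: "robust_value I n f q \<le> robust_value I n f (embed_pmf p)" if "q \<in> Delta I" for q
    using p D[OF that] by (simp add: rv e)
  have "nu_star I n f = robust_value I n f (embed_pmf p)"
    unfolding nu_star_def using mem max by (intro cSup_eq_maximum) auto
  then show ?thesis using mem max by auto
qed


section \<open>A real-arithmetic machine with a value oracle\<close>

text \<open>
  Since the functions are real-valued, algorithms are programs for a real RAM. The store consists
  of arrays of natural numbers (integer registers with indirect addressing) and arrays of reals;
  scalar variables are cells at index 0. Program constants are natural numbers only, so that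
  no information can be hidden in a real constant, and integer registers offer only addition and
  truncated subtraction. Division by zero yields 0 and there is no rounding of reals to integers.
\<close>

type_synonym vname = string

record store =
  narr :: "vname \<Rightarrow> nat \<Rightarrow> nat"
  rarr :: "vname \<Rightarrow> nat \<Rightarrow> real"

datatype nexp =
    NConst nat
  | NGet vname nexp
  | NAdd nexp nexp
  | NSub nexp nexp

datatype rexp =
    ROfNat nexp
  | RGet vname nexp
  | RAdd rexp rexp
  | RSub rexp rexp
  | RMul rexp rexp
  | RDiv rexp rexp

datatype bexp =
    NLess nexp nexp
  | RLess rexp rexp
  | BNot bexp
  | BAnd bexp bexp

fun nval :: "nexp \<Rightarrow> store \<Rightarrow> nat" where
  "nval (NConst c) s = c"
| "nval (NGet a i) s = narr s a (nval i s)"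
| "nval (NAdd x y) s = nval x s + nval y s"
| "nval (NSub x y) s = nval x s - nval y s"

fun rval :: "rexp \<Rightarrow> store \<Rightarrow> real" where
  "rval (ROfNat x) s = real (nval x s)"
| "rval (RGet a i) s = rarr s a (nval i s)"
| "rval (RAdd x y) s = rval x s + rval y s"
| "rval (RSub x y) s = rval x s - rval y s"
| "rval (RMul x y) s = rval x s * rval y s"
| "rval (RDiv x y) s = rval x s / rval y s"

fun bval :: "bexp \<Rightarrow> store \<Rightarrow> bool" where
  "bval (NLess x y) s \<longleftrightarrow> nval x s < nval y s"
| "bval (RLess x y) s \<longleftrightarrow> rval x s < rval y s"
| "bval (BNot b) s \<longleftrightarrow> \<not> bval b s"
| "bval (BAnd b b') s \<longleftrightarrow> bval b s \<and> bval b' s"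

text \<open>\<open>Query a i k b\<close> calls the oracle on index \<open>k\<close> and on the set whose characteristic vector is
  held in the array \<open>b\<close>, and stores the answer in cell \<open>i\<close> of the array \<open>a\<close>.\<close>

datatype com =
    Skip
  | NAssign vname nexp nexp
  | RAssign vname nexp rexp
  | Query vname nexp nexp vname
  | Seq com com
  | Cond bexp com com
  | While bexp com

definition nupd :: "vname \<Rightarrow> nat \<Rightarrow> nat \<Rightarrow> store \<Rightarrow> store" where
  "nupd a i v s = s\<lparr>narr := (narr s)(a := (narr s a)(i := v))\<rparr>"

definition rupd :: "vname \<Rightarrow> nat \<Rightarrow> real \<Rightarrow> store \<Rightarrow> store" where
  "rupd a i v s = s\<lparr>rarr := (rarr s)(a := (rarr s a)(i := v))\<rparr>"

text \<open>\<open>exec Q c s t s'\<close>: with oracle \<open>Q\<close>, the program \<open>c\<close> started in \<open>s\<close> halts in \<open>s'\<close> after \<open>t\<close>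
  steps. Every assignment, oracle call and test costs one step; the expressions in it have constant
  size for a fixed program, so this is unit cost per operation up to a constant factor.\<close>

inductive exec :: "(nat \<Rightarrow> nat set \<Rightarrow> real) \<Rightarrow> com \<Rightarrow> store \<Rightarrow> nat \<Rightarrow> store \<Rightarrow> bool"
  for Q :: "nat \<Rightarrow> nat set \<Rightarrow> real" where
  Skip: "exec Q Skip s 1 s"
| NAssign: "exec Q (NAssign a i x) s 1 (nupd a (nval i s) (nval x s) s)"
| RAssign: "exec Q (RAssign a i x) s 1 (rupd a (nval i s) (rval x s) s)"
| Query: "exec Q (Query a i k b) s 1 (rupd a (nval i s) (Q (nval k s) {j. narr s b j \<noteq> 0}) s)"
| Seq: "exec Q c s t s' \<Longrightarrow> exec Q c' s' t' s'' \<Longrightarrow> exec Q (Seq c c') s (t + t') s''"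
| CondTrue: "bval b s \<Longrightarrow> exec Q c s t s' \<Longrightarrow> exec Q (Cond b c c') s (Suc t) s'"
| CondFalse: "\<not> bval b s \<Longrightarrow> exec Q c' s t s' \<Longrightarrow> exec Q (Cond b c c') s (Suc t) s'"
| WhileFalse: "\<not> bval b s \<Longrightarrow> exec Q (While b c) s 1 s"
| WhileTrue: "bval b s \<Longrightarrow> exec Q c s t s' \<Longrightarrow> exec Q (While b c) s' t' s''
    \<Longrightarrow> exec Q (While b c) s (Suc (t + t')) s''"

inductive_cases exec_SkipE: "exec Q Skip s t s'"
  and exec_NAssignE: "exec Q (NAssign a i x) s t s'"
  and exec_RAssignE: "exec Q (RAssign a i x) s t s'"
  and exec_QueryE: "exec Q (Query a i k b) s t s'"
  and exec_SeqE: "exec Q (Seq c c') s t s'"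
  and exec_CondE: "exec Q (Cond b c c') s t s'"
  and exec_WhileE: "exec Q (While b c) s t s'"

lemma exec_deterministic:
  "exec Q c s t s' \<Longrightarrow> exec Q c s u s'' \<Longrightarrow> u = t \<and> s'' = s'"
proof (induction arbitrary: u s'' rule: exec.induct)
  case (Seq c s t s' c' t' s'')
  from Seq.prems show ?case
    by (rule exec_SeqE) (use Seq.IH in \<open>blast+\<close>)
next
  case (CondTrue b s c t s' c')
  from CondTrue.prems show ?case
    by (rule exec_CondE) (use CondTrue.hyps(1) CondTrue.IH in \<open>blast+\<close>)
next
  case (CondFalse b s c' t s' c)
  from CondFalse.prems show ?case
    by (rule exec_CondE) (use CondFalse.hyps(1) CondFalse.IH in \<open>blast+\<close>)
next
  case (WhileFalse b s c)
  from WhileFalse.prems show ?case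
    by (rule exec_WhileE) (use WhileFalse.hyps in simp_all)
next
  case (WhileTrue b s c t s' t' s'')
  from WhileTrue.prems show ?case
    by (rule exec_WhileE) (use WhileTrue.hyps(1) WhileTrue.IH in \<open>blast+\<close>)
next
  case Skip
  then show ?case by (rule exec_SkipE) simp
next
  case NAssign
  then show ?case by (rule exec_NAssignE) simp
next
  case RAssign
  then show ?case by (rule exec_RAssignE) simp
next
  case Query
  then show ?case by (rule exec_QueryE) simp
qed

text \<open>The program sees the ground set only through an enumeration \<open>es\<close> of its elements: it works with
  the positions \<open>0, \<dots>, length es - 1\<close>.\<close>

definition subset_at :: "'a list \<Rightarrow> nat set \<Rightarrow> 'a set" where
  "subset_at es J = {es ! j | j. j \<in> J \<and> j < length es}"

definition value_oracle :: "'a list \<Rightarrow> nat \<Rightarrow> (nat \<Rightarrow> 'a set \<Rightarrow> real) \<Rightarrow> nat \<Rightarrow> nat set \<Rightarrow> real" where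
  "value_oracle es n f k J = (if k \<in> {1..n} then f k (subset_at es J) else 0)"

definition input_store :: "nat \<Rightarrow> nat \<Rightarrow> store" where
  "input_store m n = nupd ''m'' 0 m (nupd ''n'' 0 n \<lparr>narr = \<lambda>_ _. 0, rarr = \<lambda>_ _. 0\<rparr>)"

text \<open>A distribution is output as a list of \<open>S\<close> sets with weights, the characteristic vectors being
  stored one after another in the array \<open>X\<close>. A set may occur repeatedly in the list.\<close>

definition output_set :: "'a list \<Rightarrow> store \<Rightarrow> nat \<Rightarrow> 'a set" where
  "output_set es s r = subset_at es {j. narr s ''X'' (r * length es + j) \<noteq> 0}"

definition outputs :: "'a list \<Rightarrow> store \<Rightarrow> 'a set pmf \<Rightarrow> bool" where
  "outputs es s p \<longleftrightarrow>
     (\<forall>r < narr s ''S'' 0. 0 \<le> rarr s ''w'' r) \<and>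
     (\<forall>Y. pmf p Y = (\<Sum>r | r < narr s ''S'' 0 \<and> output_set es s r = Y. rarr s ''w'' r))"

end

theory Submission
  imports Defs
begin

text \<open>
  Let \<open>\<sigma>\<^sub>k = \<Sum>\<^sub>e f\<^sub>k({e})\<close>, which bounds \<open>f\<^sub>k\<close> by subadditivity, and let \<open>\<sigma> = min\<^sub>k \<sigma>\<^sub>k\<close>. The uniform
  distribution on singletons gives every \<open>f\<^sub>k\<close> the value \<open>\<sigma>\<^sub>k / m\<close>, so \<open>\<sigma> / m \<le> \<nu>\<^sup>* \<le> \<sigma>\<close>. Mixing it in with
  probability about \<open>1 / N\<close>, where \<open>N\<close> is of order \<open>1 / \<epsilon>\<close>, satisfies all \<open>f\<^sub>k\<close> with \<open>\<sigma>\<^sub>k > N m \<sigma>\<close>; the other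
  functions have width polynomial in \<open>m\<close> relative to \<open>\<nu>\<^sup>*\<close>, and multiplicative weights need polynomially
  many rounds. A round needs a set whose value is half of the optimum for the current weighted average.
  Double greedy finds one with random choices. These are derandomized across rounds: in each round and
  for each decision some coin makes the expected increments of both deficits of the 1/2-analysis
  nonpositive. So for each element the two cumulative deficits are kept, and the choice is the one that
  moves them toward the nonpositive quadrant (as in Blackwell approachability). After \<open>T\<close> rounds the
  deficits are of order \<open>\<surd>T\<close>, which is negligible on average.
\<close>

section \<open>Double greedy with deterministic choices\<close>

text \<open>\<open>a\<close> and \<open>b\<close> are the gains from adding an element to the lower set and from removing it from the upper
  set, \<open>\<alpha>\<close> and \<open>\<beta>\<close> the deficits against an optimum without and with the element. Adding decreases
  \<open>(\<alpha>, \<beta>)\<close> by \<open>(a - 2 b, a)\<close>, removing by \<open>(b, b - 2 a)\<close>; the choice with the larger inner product with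
  \<open>(\<alpha>, \<beta>)\<close> is made.\<close>

definition balance :: "real \<Rightarrow> real \<Rightarrow> real \<Rightarrow> real \<Rightarrow> bool" where
  "balance \<alpha> \<beta> a b \<longleftrightarrow> \<not> \<alpha> * (a - 3 * b) + \<beta> * (3 * a - b) < 0"

text \<open>\<open>balance\<close> says that adding has the larger inner product,
  \<open>V \<le> U\<close>. Both cannot be negative: for positive \<open>a\<close> and
  \<open>b\<close> a positive combination of them is a square times
  \<open>\<alpha> + \<beta>\<close>; otherwise \<open>0 \<le> a + b\<close> makes every term of
  \<open>U\<close> or of \<open>V\<close> nonnegative.\<close>

lemma balance_add:
  assumes "balance \<alpha> \<beta> a b" "0 \<le> \<alpha>" "0 \<le> \<beta>" "0 \<le> a + b"
  shows "0 \<le> \<alpha> * (a - 2 * b) + \<beta> * a"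
proof -
  define U where "U = \<alpha> * (a - 2 * b) + \<beta> * a"
  define V where "V = \<alpha> * b + \<beta> * (b - 2 * a)"
  have UV: "V \<le> U" using assms(1) by (simp add: balance_def U_def V_def algebra_simps)
  show ?thesis
  proof (cases "a \<le> 0 \<or> b \<le> 0")
    case True
    then have "0 \<le> V \<or> 0 \<le> U" using assms(2-4) by (auto simp: U_def V_def)
    then show ?thesis using UV by (auto simp: U_def)
  next
    case False
    \<comment> \<open>the expectation when adding with probability \<open>a / (a + b)\<close>\<close>
    have "a * U + b * V = (\<alpha> + \<beta>) * (a - b)\<^sup>2"
      by (simp add: U_def V_def power2_eq_square algebra_simps)
    then have "0 \<le> a * U + b * V" using assms by simp
    also have "\<dots> \<le> (a + b) * U" using False UV by (simp add: algebra_simps mult_left_mono)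
    finally show ?thesis using False by (simp add: U_def[symmetric] zero_le_mult_iff)
  qed
qed

text \<open>Swapping \<open>\<alpha>\<close> with \<open>\<beta>\<close> and \<open>a\<close> with
  \<open>b\<close> exchanges the roles of adding and removing.\<close>

lemma balance_remove:
  assumes "\<not> balance \<alpha> \<beta> a b" "0 \<le> \<alpha>" "0 \<le> \<beta>" "0 \<le> a + b"
  shows "0 \<le> \<alpha> * b + \<beta> * (b - 2 * a)"
proof -
  have "balance \<beta> \<alpha> b a"
    using assms(1) by (simp add: balance_def algebra_simps)
  from balance_add[OF this] show ?thesis using assms by (simp add: algebra_simps)
qed

text \<open>The step of Blackwell approachability: the cross term of the expanded squares is at most
  0, so the squared norm grows by at most \<open>C\<close>, and truncation at 0 never increases
  it.\<close>

lemma clipped_potential: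
  fixes \<alpha> \<beta> x y :: real
  assumes "0 \<le> \<alpha> * x + \<beta> * y" "x\<^sup>2 + y\<^sup>2 \<le> C"
  shows "(max 0 (\<alpha> - x))\<^sup>2 + (max 0 (\<beta> - y))\<^sup>2 \<le> \<alpha>\<^sup>2 + \<beta>\<^sup>2 + C"
proof -
  have "(max 0 z)\<^sup>2 \<le> z\<^sup>2" for z :: real by (simp add: max_def)
  from this[of "\<alpha> - x"] this[of "\<beta> - y"] show ?thesis
    using assms by (simp add: power2_eq_square algebra_simps)
qed

text \<open>The constant 10 = 9 + 1 bounds the growth of the squared norm of the deficits in one
  decision.\<close>

lemma unit_squares_bound:
  fixes a b :: real
  assumes "\<bar>a\<bar> \<le> 1" "\<bar>b\<bar> \<le> 1"
  shows "(a - 2 * b)\<^sup>2 + a\<^sup>2 \<le> 10"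
proof -
  have "a\<^sup>2 \<le> 1" using assms by (simp add: abs_square_le_1)
  moreover have "\<bar>a - 2 * b\<bar> \<le> 3" using assms by linarith
  then have "(a - 2 * b)\<^sup>2 \<le> 3\<^sup>2" by (metis abs_le_square_iff abs_numeral)
  ultimately show ?thesis by simp
qed

section \<open>Submodularity in one decision of double greedy\<close>

lemma submodular_onD:
  "submodular_on E F \<Longrightarrow> X \<subseteq> E \<Longrightarrow> Y \<subseteq> E \<Longrightarrow> F (X \<union> Y) + F (X \<inter> Y) \<le> F X + F Y"
  unfolding submodular_on_def by blast

context
  fixes E A B :: "'b set" and F :: "'b set \<Rightarrow> real" and i :: 'b and a b :: real
  assumes sub: "submodular_on E F" and AB: "A \<subseteq> B" "B \<subseteq> E" "i \<in> B" "i \<notin> A"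
  defines "a \<equiv> F (insert i A) - F A" and "b \<equiv> F (B - {i}) - F B"
begin

lemma marginals_nonneg: "0 \<le> a + b"
proof -
  have "insert i A \<union> (B - {i}) = B" "insert i A \<inter> (B - {i}) = A" using AB by auto
  then show ?thesis
    using submodular_onD[OF sub, of "insert i A" "B - {i}"] AB by (force simp: a_def b_def)
qed

text \<open>Diminishing returns: if \<open>i\<close> is not in \<open>Z\<close>, then
  \<open>(Z \<union> A) \<inter> B\<close> is a subset of \<open>B - {i}\<close>, so the marginal
  value of \<open>i\<close> there is at least the one at \<open>B - {i}\<close>, which is
  \<open>- b\<close>.\<close>

lemma loss_add:
  assumes Z: "Z \<subseteq> E"
  shows "F ((Z \<union> A) \<inter> B) - F ((Z \<union> insert i A) \<inter> B) \<le> (if i \<in> Z then 0 else b)"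
proof (cases "i \<in> Z")
  case False
  have "(Z \<union> insert i A) \<inter> B \<union> (B - {i}) = B" "(Z \<union> insert i A) \<inter> B \<inter> (B - {i}) = (Z \<union> A) \<inter> B"
    using AB False by auto
  then show ?thesis
    using submodular_onD[OF sub, of "(Z \<union> insert i A) \<inter> B" "B - {i}"] AB False by (force simp: b_def)
qed (simp add: insert_absorb)

text \<open>Diminishing returns at the lower set: \<open>(Z \<union> A) \<inter> (B - {i})\<close>
  contains \<open>A\<close>, so \<open>i\<close> is worth at most \<open>a\<close> there.\<close>

lemma loss_remove:
  assumes Z: "Z \<subseteq> E"
  shows "F ((Z \<union> A) \<inter> B) - F ((Z \<union> A) \<inter> (B - {i})) \<le> (if i \<in> Z then a else 0)"
proof (cases "i \<in> Z")
  case True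
  have "(Z \<union> A) \<inter> (B - {i}) \<union> insert i A = (Z \<union> A) \<inter> B" "(Z \<union> A) \<inter> (B - {i}) \<inter> insert i A = A"
    using AB True by auto
  then show ?thesis
    using submodular_onD[OF sub, of "(Z \<union> A) \<inter> (B - {i})" "insert i A"] AB True by (force simp: a_def)
next
  case False
  then have "(Z \<union> A) \<inter> B = (Z \<union> A) \<inter> (B - {i})" using AB by auto
  then show ?thesis using False by simp
qed

end

lemma submodular_le_sum_singletons:
  assumes "submodular_on E F" "\<And>X. X \<subseteq> E \<Longrightarrow> 0 \<le> F X" "F {} = 0" "finite E" "X \<subseteq> E"
  shows "F X \<le> (\<Sum>e\<in>E. F {e})"
proof -
  have "finite X" using assms finite_subset by blast
  then have "F X \<le> (\<Sum>e\<in>X. F {e})" using \<open>X \<subseteq> E\<close>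
  proof (induction X rule: finite_induct)
    case (insert e X)
    then show ?case
      using submodular_onD[OF assms(1), of "{e}" X] assms(2)[of "{e} \<inter> X"] by simp
  qed (simp add: assms)
  also have "\<dots> \<le> (\<Sum>e\<in>E. F {e})" using assms by (intro sum_mono2) auto
  finally show ?thesis .
qed

section \<open>Multiplicative weights\<close>

text \<open>A large gain lowers the weight of a function, so the average gain \<open>g\<close>
  cannot much exceed the gain of any single \<open>k\<close>. The proof compares the weight of
  \<open>k\<close> with the total weight on a logarithmic scale.\<close>

lemma multiplicative_weights:
  fixes h :: "'k \<Rightarrow> nat \<Rightarrow> real" and \<eta> :: real and K :: "'k set"
  defines "v \<equiv> \<lambda>t k. \<Prod>\<tau><t. 1 - \<eta> * h k \<tau>"
  defines "g \<equiv> \<lambda>t. (\<Sum>k\<in>K. v t k * h k t) / (\<Sum>k\<in>K. v t k)"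
  assumes K: "finite K" "k \<in> K" and h: "\<And>k t. k \<in> K \<Longrightarrow> 0 \<le> h k t \<and> h k t \<le> 1"
    and \<eta>: "0 < \<eta>" "\<eta> \<le> 1/2"
  shows "(\<Sum>t<T. g t) \<le> (1 + 2 * \<eta>) * (\<Sum>t<T. h k t) + real (card K) / \<eta>"
proof -
  have eh: "0 \<le> \<eta> * h k t \<and> \<eta> * h k t \<le> \<eta>" if "k \<in> K" for k t
    using h[OF that, of t] \<eta> by (simp add: mult_left_le)
  have fpos: "0 < 1 - \<eta> * h k t" if "k \<in> K" for k t
    using eh[OF that, of t] \<eta> by linarith
  have vpos: "0 < v t k" if "k \<in> K" for t k
    unfolding v_def using fpos[OF that] by (intro prod_pos) auto
  have Wpos: "0 < (\<Sum>k\<in>K. v t k)" for t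
    using K vpos by (intro sum_pos) auto
  have g01: "0 \<le> g t \<and> g t \<le> 1" for t
  proof -
    have "(\<Sum>k\<in>K. v t k * h k t) \<le> (\<Sum>k\<in>K. v t k)"
      using vpos h by (intro sum_mono) (simp add: mult_left_le less_imp_le)
    moreover have "0 \<le> (\<Sum>k\<in>K. v t k * h k t)"
      using vpos h by (intro sum_nonneg) (simp add: less_imp_le)
    ultimately show ?thesis using Wpos[of t] by (simp add: g_def)
  qed
  have gpos: "0 < 1 - \<eta> * g t" for t
    using mult_left_le[of "g t" \<eta>] g01[of t] \<eta> by linarith
  \<comment> \<open>The average uses the current weights, so an update shrinks the total by exactly
    the factor \<open>1 - \<eta> * g t\<close>.\<close>
  have W: "(\<Sum>k\<in>K. v t k) = real (card K) * (\<Prod>\<tau><t. 1 - \<eta> * g \<tau>)" for t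
  proof (induction t)
    case (Suc t)
    have "(\<Sum>k\<in>K. v (Suc t) k) = (\<Sum>k\<in>K. v t k) - \<eta> * (\<Sum>k\<in>K. v t k * h k t)"
      by (simp add: v_def algebra_simps sum_subtractf sum_distrib_left)
    also have "\<dots> = (\<Sum>k\<in>K. v t k) * (1 - \<eta> * g t)"
      using Wpos[of t] by (simp add: g_def field_simps)
    finally show ?case by (simp add: Suc)
  qed (simp add: v_def)
  have cK: "0 < card K" using K by (auto simp: card_gt_0_iff)
  have "v T k \<le> (\<Sum>k\<in>K. v T k)"
    using K vpos by (intro member_le_sum) (auto simp: less_imp_le)
  then have "ln (v T k) \<le> ln (real (card K) * (\<Prod>t<T. 1 - \<eta> * g t))"
    using vpos[OF K(2)] Wpos W by (subst ln_le_cancel_iff) (auto simp: less_imp_le)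
  moreover have "0 < (\<Prod>t<T. 1 - \<eta> * g t)" using gpos by (intro prod_pos) auto
  moreover have "ln (\<Prod>t<T. 1 - \<eta> * g t) = (\<Sum>t<T. ln (1 - \<eta> * g t))"
    using gpos by (intro ln_prod) (auto simp: less_imp_neq[symmetric])
  moreover have "ln (v T k) = (\<Sum>t<T. ln (1 - \<eta> * h k t))"
    unfolding v_def using fpos[OF K(2)] by (intro ln_prod) (auto simp: less_imp_neq[symmetric])
  ultimately have "(\<Sum>t<T. ln (1 - \<eta> * h k t)) \<le> ln (real (card K)) + (\<Sum>t<T. ln (1 - \<eta> * g t))"
    using cK by (simp add: ln_mult_pos)
  moreover have "(\<Sum>t<T. - (\<eta> * (1 + 2 * \<eta>) * h k t)) \<le> (\<Sum>t<T. ln (1 - \<eta> * h k t))"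
  proof (intro sum_mono)
    fix t
    let ?x = "\<eta> * h k t"
    have "- ?x - 2 * ?x\<^sup>2 \<le> ln (1 - ?x)"
      using eh[OF K(2), of t] \<eta> by (intro ln_one_minus_pos_lower_bound) linarith+
    moreover have "?x\<^sup>2 \<le> \<eta> * ?x"
      using eh[OF K(2), of t] by (simp add: power2_eq_square mult_right_mono)
    ultimately show "- (\<eta> * (1 + 2 * \<eta>) * h k t) \<le> ln (1 - ?x)" by (simp add: algebra_simps)
  qed
  moreover have "(\<Sum>t<T. ln (1 - \<eta> * g t)) \<le> (\<Sum>t<T. - (\<eta> * g t))"
  proof (intro sum_mono)
    show "ln (1 - \<eta> * g t) \<le> - (\<eta> * g t)" for t
      using ln_le_minus_one[OF gpos[of t]] by linarith
  qed
  \<comment> \<open>Giving up the logarithm costs only a polynomial factor in the number of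
    rounds.\<close>
  moreover have "ln (real (card K)) \<le> real (card K)" using cK ln_le_minus_one[of "real (card K)"] by simp
  ultimately have "\<eta> * (\<Sum>t<T. g t) \<le> \<eta> * (1 + 2 * \<eta>) * (\<Sum>t<T. h k t) + real (card K)"
    by (simp add: sum_negf sum_distrib_left)
  then show ?thesis using \<eta> by (simp add: field_simps)
qed

text \<open>\<open>P\<close> and \<open>R\<close> hold the deficits of each element, \<open>P\<^sub>0\<close> and \<open>R\<^sub>0\<close> their values before the round;
  \<open>(Z \<union> A) \<inter> B\<close> is the optimum \<open>Z\<close> modified by the first \<open>i\<close> decisions.\<close>

definition greedy_inv ::
  "nat \<Rightarrow> (nat set \<Rightarrow> real) \<Rightarrow> (nat \<Rightarrow> real) \<Rightarrow> (nat \<Rightarrow> real) \<Rightarrow> nat \<Rightarrow>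
    nat set \<Rightarrow> nat set \<Rightarrow> (nat \<Rightarrow> real) \<Rightarrow> (nat \<Rightarrow> real) \<Rightarrow> bool" where
  "greedy_inv m F P\<^sub>0 R\<^sub>0 i A B P R \<longleftrightarrow>
     A \<subseteq> {..<i} \<and> B = A \<union> {i..<m} \<and>
     (\<forall>j. 0 \<le> P j \<and> 0 \<le> R j) \<and>
     (\<forall>j<i. (P j)\<^sup>2 + (R j)\<^sup>2 \<le> (P\<^sub>0 j)\<^sup>2 + (R\<^sub>0 j)\<^sup>2 + 10) \<and>
     (\<forall>j\<ge>i. P j = P\<^sub>0 j \<and> R j = R\<^sub>0 j) \<and>
     (\<forall>Z\<subseteq>{..<m}. 2 * (F Z - F ((Z \<union> A) \<inter> B)) - (F A + F B - F {..<m})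
        \<le> (\<Sum>j<i. if j \<in> Z then R j - R\<^sub>0 j else P j - P\<^sub>0 j))"

text \<open>Twice the loss of the modified optimum minus the gain of the two sets is at most
  \<open>2 * b - a\<close> or \<open>- a\<close> after adding, and \<open>- b\<close> or
  \<open>2 * a - b\<close> after removing, for \<open>Z\<close> without or with \<open>i\<close>.
  These are the changes of \<open>P i\<close> and \<open>R i\<close> before truncation.\<close>

lemma greedy_inv_step:
  assumes F: "submodular_on {..<m} F" "\<And>Y. Y \<subseteq> {..<m} \<Longrightarrow> 0 \<le> F Y \<and> F Y \<le> 1"
    and i: "i < m" and inv: "greedy_inv m F P\<^sub>0 R\<^sub>0 i A B P R"
    and ab: "a = F (insert i A) - F A" "b = F (B - {i}) - F B"
  shows "balance (P i) (R i) a b \<Longrightarrow> greedy_inv m F P\<^sub>0 R\<^sub>0 (Suc i) (insert i A) B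
      (P(i := max 0 (P i - (a - 2 * b)))) (R(i := max 0 (R i - a)))"
    and "\<not> balance (P i) (R i) a b \<Longrightarrow> greedy_inv m F P\<^sub>0 R\<^sub>0 (Suc i) A (B - {i})
      (P(i := max 0 (P i - b))) (R(i := max 0 (R i - (b - 2 * a))))"
proof -
  have A: "A \<subseteq> {..<i}" and B: "B = A \<union> {i..<m}" and nonneg: "0 \<le> P i" "0 \<le> R i"
    and eq: "P i = P\<^sub>0 i" "R i = R\<^sub>0 i"
    and loss: "\<And>Z. Z \<subseteq> {..<m} \<Longrightarrow> 2 * (F Z - F ((Z \<union> A) \<inter> B)) - (F A + F B - F {..<m})
        \<le> (\<Sum>j<i. if j \<in> Z then R j - R\<^sub>0 j else P j - P\<^sub>0 j)"
    using inv unfolding greedy_inv_def by (blast intro: order_refl)+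
  have sub: "A \<subseteq> B" "B \<subseteq> {..<m}" "i \<in> B" "i \<notin> A" using A B i by auto
  have pos: "0 \<le> a + b" using marginals_nonneg[OF F(1) sub] by (simp add: ab)
  have "insert i A \<subseteq> {..<m}" "A \<subseteq> {..<m}" "B - {i} \<subseteq> {..<m}" using sub i by auto
  then have "0 \<le> F (insert i A)" "F (insert i A) \<le> 1" "0 \<le> F A" "F A \<le> 1"
    "0 \<le> F (B - {i})" "F (B - {i}) \<le> 1" "0 \<le> F B" "F B \<le> 1"
    using F(2) sub by blast+
  then have small: "\<bar>a\<bar> \<le> 1" "\<bar>b\<bar> \<le> 1" by (auto simp: ab)
  have cong: "(\<Sum>j<i. if j \<in> Z then (R(i := r)) j - R\<^sub>0 j else (P(i := p)) j - P\<^sub>0 j) =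
      (\<Sum>j<i. if j \<in> Z then R j - R\<^sub>0 j else P j - P\<^sub>0 j)" for Z r p
    by (intro sum.cong) auto
  have step: "greedy_inv m F P\<^sub>0 R\<^sub>0 (Suc i) A' B' (P(i := p)) (R(i := r))"
    if "A' \<subseteq> {..<Suc i}" "B' = A' \<union> {Suc i..<m}" "0 \<le> p" "0 \<le> r"
      "p\<^sup>2 + r\<^sup>2 \<le> (P\<^sub>0 i)\<^sup>2 + (R\<^sub>0 i)\<^sup>2 + 10"
      and l: "\<And>Z. Z \<subseteq> {..<m} \<Longrightarrow> 2 * (F Z - F ((Z \<union> A') \<inter> B')) - (F A' + F B' - F {..<m})
        \<le> (\<Sum>j<i. if j \<in> Z then R j - R\<^sub>0 j else P j - P\<^sub>0 j) + (if i \<in> Z then r - R\<^sub>0 i else p - P\<^sub>0 i)"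
    for A' B' p r
    unfolding greedy_inv_def
  proof (intro conjI)
    show "\<forall>Z\<subseteq>{..<m}. 2 * (F Z - F ((Z \<union> A') \<inter> B')) - (F A' + F B' - F {..<m})
        \<le> (\<Sum>j<Suc i. if j \<in> Z then (R(i := r)) j - R\<^sub>0 j else (P(i := p)) j - P\<^sub>0 j)"
      using l by (simp only: sum.lessThan_Suc cong fun_upd_same) blast
    show "\<forall>j. 0 \<le> (P(i := p)) j \<and> 0 \<le> (R(i := r)) j"
      using that(3,4) inv by (simp add: greedy_inv_def)
    show "\<forall>j<Suc i. ((P(i := p)) j)\<^sup>2 + ((R(i := r)) j)\<^sup>2 \<le> (P\<^sub>0 j)\<^sup>2 + (R\<^sub>0 j)\<^sup>2 + 10"
      using that(5) inv by (simp add: greedy_inv_def less_Suc_eq)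
    show "\<forall>j\<ge>Suc i. (P(i := p)) j = P\<^sub>0 j \<and> (R(i := r)) j = R\<^sub>0 j"
      using inv by (simp add: greedy_inv_def)
  qed (fact that(1,2))+
  show "greedy_inv m F P\<^sub>0 R\<^sub>0 (Suc i) (insert i A) B
      (P(i := max 0 (P i - (a - 2 * b)))) (R(i := max 0 (R i - a)))"
    if bal: "balance (P i) (R i) a b"
  proof (rule step)
    show "(max 0 (P i - (a - 2 * b)))\<^sup>2 + (max 0 (R i - a))\<^sup>2 \<le> (P\<^sub>0 i)\<^sup>2 + (R\<^sub>0 i)\<^sup>2 + 10"
      using clipped_potential[OF balance_add[OF bal nonneg pos] unit_squares_bound[OF small]]
      by (simp add: eq)
  next
    fix Z assume Z: "Z \<subseteq> {..<m}"
    \<comment> \<open>Truncation at 0 only raises the new deficits, which stand on the larger side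
      of the inequality.\<close>
    note mx = max.cobounded2[of "R i - a" 0] max.cobounded2[of "P i - (a - 2 * b)" 0]
    show "2 * (F Z - F ((Z \<union> insert i A) \<inter> B)) - (F (insert i A) + F B - F {..<m})
        \<le> (\<Sum>j<i. if j \<in> Z then R j - R\<^sub>0 j else P j - P\<^sub>0 j) +
          (if i \<in> Z then max 0 (R i - a) - R\<^sub>0 i else max 0 (P i - (a - 2 * b)) - P\<^sub>0 i)"
    proof (cases "i \<in> Z")
      case True
      with loss[OF Z] loss_add[OF F(1) sub Z, folded ab] mx show ?thesis
        unfolding if_P[OF True] using ab eq by argo
    next
      case False
      with loss[OF Z] loss_add[OF F(1) sub Z, folded ab] mx show ?thesis
        unfolding if_not_P[OF False] using ab eq by argo
    qed
  qed (use A B i in auto)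
  show "greedy_inv m F P\<^sub>0 R\<^sub>0 (Suc i) A (B - {i})
      (P(i := max 0 (P i - b))) (R(i := max 0 (R i - (b - 2 * a))))"
    if unbal: "\<not> balance (P i) (R i) a b"
  proof (rule step)
    have "b\<^sup>2 + (b - 2 * a)\<^sup>2 \<le> 10" using unit_squares_bound[OF small(2,1)] by simp
    from clipped_potential[OF balance_remove[OF unbal nonneg pos] this]
    show "(max 0 (P i - b))\<^sup>2 + (max 0 (R i - (b - 2 * a)))\<^sup>2 \<le> (P\<^sub>0 i)\<^sup>2 + (R\<^sub>0 i)\<^sup>2 + 10"
      by (simp add: eq)
  next
    fix Z assume Z: "Z \<subseteq> {..<m}"
    note mx = max.cobounded2[of "R i - (b - 2 * a)" 0] max.cobounded2[of "P i - b" 0]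
    show "2 * (F Z - F ((Z \<union> A) \<inter> (B - {i}))) - (F A + F (B - {i}) - F {..<m})
        \<le> (\<Sum>j<i. if j \<in> Z then R j - R\<^sub>0 j else P j - P\<^sub>0 j) +
          (if i \<in> Z then max 0 (R i - (b - 2 * a)) - R\<^sub>0 i else max 0 (P i - b) - P\<^sub>0 i)"
    proof (cases "i \<in> Z")
      case True
      with loss[OF Z] loss_remove[OF F(1) sub Z, folded ab] mx show ?thesis
        unfolding if_P[OF True] using ab eq by argo
    next
      case False
      with loss[OF Z] loss_remove[OF F(1) sub Z, folded ab] mx show ?thesis
        unfolding if_not_P[OF False] using ab eq by argo
    qed
  qed (use A B i in auto)
qed

section \<open>Program logic with running times\<close>

primrec nmod :: "com \<Rightarrow> vname set" where
  "nmod Skip = {}"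
| "nmod (NAssign a i x) = {a}"
| "nmod (RAssign a i x) = {}"
| "nmod (Query a i k b) = {}"
| "nmod (Seq c d) = nmod c \<union> nmod d"
| "nmod (Cond b c d) = nmod c \<union> nmod d"
| "nmod (While b c) = nmod c"

primrec rmod :: "com \<Rightarrow> vname set" where
  "rmod Skip = {}"
| "rmod (NAssign a i x) = {}"
| "rmod (RAssign a i x) = {a}"
| "rmod (Query a i k b) = {a}"
| "rmod (Seq c d) = rmod c \<union> rmod d"
| "rmod (Cond b c d) = rmod c \<union> rmod d"
| "rmod (While b c) = rmod c"

text \<open>A frame condition on whole arrays; the arrays written are collected
  syntactically.\<close>

definition agree :: "com \<Rightarrow> store \<Rightarrow> store \<Rightarrow> bool" where
  "agree c s s' \<longleftrightarrow>
     (\<forall>a. a \<notin> nmod c \<longrightarrow> narr s' a = narr s a) \<and> (\<forall>a. a \<notin> rmod c \<longrightarrow> rarr s' a = rarr s a)"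

lemma exec_agree: "exec Q c s t s' \<Longrightarrow> agree c s s'"
  by (induction rule: exec.induct) (auto simp: agree_def nupd_def rupd_def)

lemma agree_narr: "agree c s s' \<Longrightarrow> a \<notin> nmod c \<Longrightarrow> narr s' a = narr s a"
  and agree_rarr: "agree c s s' \<Longrightarrow> a \<notin> rmod c \<Longrightarrow> rarr s' a = rarr s a"
  by (auto simp: agree_def)

definition runs :: "(nat \<Rightarrow> nat set \<Rightarrow> real) \<Rightarrow> com \<Rightarrow> store \<Rightarrow> nat \<Rightarrow> (store \<Rightarrow> bool) \<Rightarrow> bool" where
  "runs Q c s b R \<longleftrightarrow> (\<exists>t s'. exec Q c s t s' \<and> t \<le> b \<and> R s')"

text \<open>Rule of consequence. The frame condition comes for free from \<open>exec_agree\<close>,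
  so postconditions need to mention only what a command changes.\<close>

lemma runs_weaken:
  "runs Q c s b R \<Longrightarrow> b \<le> b' \<Longrightarrow> (\<And>s'. agree c s s' \<Longrightarrow> R s' \<Longrightarrow> R' s') \<Longrightarrow> runs Q c s b' R'"
  unfolding runs_def by (meson exec_agree order_trans)

lemma runs_Seq:
  assumes "runs Q c s b R" "\<And>s'. agree c s s' \<Longrightarrow> R s' \<Longrightarrow> runs Q d s' b' R'"
  shows "runs Q (Seq c d) s (b + b') R'"
  using assms unfolding runs_def by (meson exec.Seq exec_agree add_mono)

lemma runs_Cond:
  assumes "bval e s \<Longrightarrow> runs Q c s b R" "\<not> bval e s \<Longrightarrow> runs Q d s b R"
  shows "runs Q (Cond e c d) s (Suc b) R"
  using assms unfolding runs_def by (cases "bval e s") (meson exec.CondTrue exec.CondFalse Suc_le_mono)+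

text \<open>The invariant is indexed by the number of completed iterations. Each of the
  \<open>K\<close> iterations pays one extra step for its test, and the failing test pays the last
  one.\<close>

lemma runs_While:
  assumes "I 0 s"
    and step: "\<And>j s. j < K \<Longrightarrow> I j s \<Longrightarrow> bval e s \<and> runs Q c s b (I (Suc j))"
    and stop: "\<And>s. I K s \<Longrightarrow> \<not> bval e s"
  shows "runs Q (While e c) s (K * Suc b + 1) (I K)"
proof -
  \<comment> \<open>Here \<open>j\<close> counts the iterations still to come.\<close>
  have "I (K - j) s \<Longrightarrow> j \<le> K \<Longrightarrow> runs Q (While e c) s (j * Suc b + 1) (I K)" for j s
  proof (induction j arbitrary: s)
    case 0
    then show ?case using stop exec.WhileFalse[of e s Q c] by (auto simp: runs_def)
  next
    case (Suc j)
    then have *: "bval e s" "runs Q c s b (I (Suc (K - Suc j)))" using step[of "K - Suc j" s] by auto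
    then obtain t s' where 1: "exec Q c s t s'" "t \<le> b" "I (K - j) s'"
      using Suc.prems by (auto simp: runs_def Suc_diff_Suc)
    have "runs Q (While e c) s' (j * Suc b + 1) (I K)" using Suc.IH[OF 1(3)] Suc.prems by simp
    then obtain t' s'' where 2: "exec Q (While e c) s' t' s''" "t' \<le> j * Suc b + 1" "I K s''"
      unfolding runs_def by blast
    have "exec Q (While e c) s (Suc (t + t')) s''" using * 1 2 by (intro exec.WhileTrue)
    moreover have "Suc (t + t') \<le> Suc j * Suc b + 1" using 1 2 by simp
    ultimately show ?case using 2 by (auto simp: runs_def)
  qed
  from this[of K s] assms(1) show ?thesis by simp
qed

section \<open>Loop-free commands and counted loops\<close>

primrec straight_line :: "com \<Rightarrow> bool" where
  "straight_line Skip = True"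
| "straight_line (NAssign a i x) = True"
| "straight_line (RAssign a i x) = True"
| "straight_line (Query a i k b) = True"
| "straight_line (Seq c d) = (straight_line c \<and> straight_line d)"
| "straight_line (Cond b c d) = (straight_line c \<and> straight_line d)"
| "straight_line (While b c) = False"

primrec cost :: "com \<Rightarrow> nat" where
  "cost Skip = 1"
| "cost (NAssign a i x) = 1"
| "cost (RAssign a i x) = 1"
| "cost (Query a i k b) = 1"
| "cost (Seq c d) = cost c + cost d"
| "cost (Cond b c d) = Suc (max (cost c) (cost d))"
| "cost (While b c) = 0"

definition members :: "vname \<Rightarrow> store \<Rightarrow> nat set" where
  "members a s = {j. narr s a j \<noteq> 0}"

primrec den :: "(nat \<Rightarrow> nat set \<Rightarrow> real) \<Rightarrow> com \<Rightarrow> store \<Rightarrow> store" where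
  "den Q Skip s = s"
| "den Q (NAssign a i x) s = nupd a (nval i s) (nval x s) s"
| "den Q (RAssign a i x) s = rupd a (nval i s) (rval x s) s"
| "den Q (Query a i k b) s = rupd a (nval i s) (Q (nval k s) (members b s)) s"
| "den Q (Seq c d) s = den Q d (den Q c s)"
| "den Q (Cond b c d) s = (if bval b s then den Q c s else den Q d s)"
| "den Q (While b c) s = s"

text \<open>Reduces the verification of loop-free commands to simplification with \<open>den\<close>
  and \<open>cost\<close>.\<close>

lemma runs_straight_line:
  assumes "straight_line c" "cost c \<le> b" "R (den Q c s)"
  shows "runs Q c s b R"
proof -
  have "runs Q c s (cost c) (\<lambda>s'. s' = den Q c s)" using assms(1)
  proof (induction c arbitrary: s)
    case (Seq c d)
    then show ?case by (auto intro: runs_Seq)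
  next
    case (Cond e c d)
    show ?case
      unfolding cost.simps den.simps
      by (intro runs_Cond) (use Cond.prems in \<open>auto intro: runs_weaken[OF Cond.IH(1)] runs_weaken[OF Cond.IH(2)]\<close>)
  next
    case (Query a i k b)
    then show ?case unfolding runs_def cost.simps den.simps members_def by (blast intro: exec.Query)
  qed (auto simp: runs_def intro: exec.intros)
  then show ?thesis using assms by (auto elim: runs_weaken)
qed

abbreviation NVar :: "vname \<Rightarrow> nexp" where
  "NVar x \<equiv> NGet x (NConst 0)"

abbreviation RVar :: "vname \<Rightarrow> rexp" where
  "RVar x \<equiv> RGet x (NConst 0)"

definition For :: "vname \<Rightarrow> vname \<Rightarrow> com \<Rightarrow> com" where
  "For x y c = Seq (NAssign x (NConst 0) (NConst 0))
     (While (NLess (NVar x) (NVar y)) (Seq c (NAssign x (NConst 0) (NAdd (NVar x) (NConst 1)))))"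

lemma nmod_For [simp]: "nmod (For x y c) = insert x (nmod c)"
  and rmod_For [simp]: "rmod (For x y c) = rmod c"
  by (auto simp: For_def)

lemma narr_nupd [simp]: "narr (nupd a i v s) = (narr s)(a := (narr s a)(i := v))"
  and rarr_nupd [simp]: "rarr (nupd a i v s) = rarr s"
  and narr_rupd [simp]: "narr (rupd a i r s) = narr s"
  and rarr_rupd [simp]: "rarr (rupd a i r s) = (rarr s)(a := (rarr s a)(i := r))"
  by (auto simp: nupd_def rupd_def)

lemma members_nupd [simp]:
    "members b (nupd a i v s) =
      (if a = b then if v = 0 then members b s - {i} else insert i (members b s) else members b s)"
  and members_rupd [simp]: "members b (rupd a i r s) = members b s"
  by (auto simp: members_def)

lemma agree_members: "agree c s s' \<Longrightarrow> a \<notin> nmod c \<Longrightarrow> members a s' = members a s"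
  by (simp add: agree_narr members_def)

text \<open>The counter and the frame condition are tracked in \<open>J\<close>, so \<open>I\<close>
  describes only the effect of the body; \<open>indep\<close> lets it survive the writes to the
  counter. Test and increment add 2 to each iteration, initialization and last test add 2
  overall.\<close>

lemma runs_For:
  assumes xy: "x \<noteq> y" "x \<notin> nmod c" "y \<notin> nmod c"
    and I0: "I 0 s" and K: "narr s y 0 = K"
    and indep: "\<And>j s v. I j s \<Longrightarrow> I j (nupd x 0 v s)"
    and step: "\<And>j s'. j < K \<Longrightarrow> agree (For x y c) s s' \<Longrightarrow> narr s' x 0 = j \<Longrightarrow> I j s'
      \<Longrightarrow> runs Q c s' b (I (Suc j))"
  shows "runs Q (For x y c) s (K * (b + 2) + 2) (I K)"
proof -
  define J where "J = (\<lambda>j s'. agree (For x y c) s s' \<and> narr s' x 0 = j \<and> I j s')"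
  have "runs Q (While (NLess (NVar x) (NVar y)) (Seq c (NAssign x (NConst 0) (NAdd (NVar x) (NConst 1)))))
          (nupd x 0 0 s) (K * Suc (b + 1) + 1) (J K)"
  proof (rule runs_While)
    show "J 0 (nupd x 0 0 s)"
      using I0 indep by (auto simp: J_def agree_def)
  next
    fix j s' assume j: "j < K" and J: "J j s'"
    have y: "narr s' y 0 = K"
      using J xy K agree_narr[of "For x y c" s s' y] by (simp add: J_def)
    have "runs Q (Seq c (NAssign x (NConst 0) (NAdd (NVar x) (NConst 1)))) s' (b + 1) (J (Suc j))"
    proof (rule runs_Seq)
      show "runs Q c s' b (I (Suc j))" using J j step by (auto simp: J_def)
    next
      fix s'' assume a: "agree c s' s''" and I: "I (Suc j) s''"
      have "narr s'' x = narr s' x" using a xy by (simp add: agree_narr)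
      then show "runs Q (NAssign x (NConst 0) (NAdd (NVar x) (NConst 1))) s'' 1 (J (Suc j))"
        using a I J indep by (intro runs_straight_line) (auto simp: J_def agree_def)
    qed
    then show "bval (NLess (NVar x) (NVar y)) s' \<and>
        runs Q (Seq c (NAssign x (NConst 0) (NAdd (NVar x) (NConst 1)))) s' (b + 1) (J (Suc j))"
      using y j J by (simp add: J_def)
  next
    fix s' assume "J K s'"
    then show "\<not> bval (NLess (NVar x) (NVar y)) s'"
      using xy K agree_narr[of "For x y c" s s' y] by (simp add: J_def)
  qed
  then have "runs Q (While (NLess (NVar x) (NVar y)) (Seq c (NAssign x (NConst 0) (NAdd (NVar x) (NConst 1)))))
          (nupd x 0 0 s) (K * (b + 2) + 1) (I K)"
    by (rule runs_weaken) (auto simp: J_def)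
  then have "runs Q (For x y c) s (1 + (K * (b + 2) + 1)) (I K)"
    unfolding For_def
    by (intro runs_Seq[where R = "\<lambda>s'. s' = nupd x 0 0 s"]) (auto intro: runs_straight_line)
  then show ?thesis by simp
qed

section \<open>The program\<close>

abbreviation seq :: "com \<Rightarrow> com \<Rightarrow> com" (infixr ";;" 60) where
  "c ;; d \<equiv> Seq c d"

abbreviation RConst :: "nat \<Rightarrow> rexp" where
  "RConst c \<equiv> ROfNat (NConst c)"

text \<open>Real arrays: \<open>g\<close> holds the sums of singleton values, \<open>v\<close> the weights of the functions (with sum \<open>W\<close>),
  \<open>c\<close> the width bound, \<open>P\<close> and \<open>R\<close> the deficits. Integer arrays: \<open>A\<close> and \<open>B\<close> are the lower and
  upper set of double greedy, \<open>p\<close> the first free position of \<open>X\<close>. The loop counter \<open>k\<close> starts at 0 and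
  stands for the function with index \<open>k + 1\<close>.\<close>

definition add_singleton :: com where
  "add_singleton =
     NAssign ''D'' (NVar ''i'') (NConst 1) ;;
     Query ''x'' (NConst 0) (NAdd (NVar ''k'') (NConst 1)) ''D'' ;;
     NAssign ''D'' (NVar ''i'') (NConst 0) ;;
     RAssign ''g'' (NVar ''k'') (RAdd (RGet ''g'' (NVar ''k'')) (RVar ''x''))"

text \<open>The first function always sets \<open>z\<close>, whose initial value 0 would spoil a
  minimum of nonnegative sums.\<close>

definition min_singleton_sums :: com where
  "min_singleton_sums =
     For ''k'' ''n''
       (For ''i'' ''m'' add_singleton ;;
        Cond (BAnd (NLess (NConst 0) (NVar ''k'')) (BNot (RLess (RGet ''g'' (NVar ''k'')) (RVar ''z''))))
          Skip (RAssign ''z'' (NConst 0) (RGet ''g'' (NVar ''k''))))"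

text \<open>Later updates only multiply weights, so a function above the width bound
  \<open>c\<close> keeps weight 0 throughout.\<close>

definition init_weights :: "nat \<Rightarrow> com" where
  "init_weights N =
     RAssign ''c'' (NConst 0) (RMul (RMul (RConst N) (ROfNat (NVar ''m''))) (RVar ''z'')) ;;
     For ''k'' ''n''
       (Cond (RLess (RVar ''c'') (RGet ''g'' (NVar ''k'')))
         (RAssign ''v'' (NVar ''k'') (RConst 0)) (RAssign ''v'' (NVar ''k'') (RConst 1)))"

text \<open>The exponents come from \<open>rounds_large\<close>; \<open>m + 1\<close> in place of
  \<open>m\<close> keeps the number of rounds positive for an empty ground set.\<close>

definition rounds_exp :: "nat \<Rightarrow> rexp" where
  "rounds_exp N =
     (let h = RMul (ROfNat (NAdd (NVar ''m'') (NConst 1))) (ROfNat (NAdd (NVar ''m'') (NConst 1)))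
      in RMul (RMul (RConst (N ^ 4)) (RMul h (RMul h h))) (ROfNat (NVar ''n'')))"

text \<open>Counting up to a real bound yields products of integer registers, which cannot be multiplied.\<close>

definition compute_rounds :: "nat \<Rightarrow> com" where
  "compute_rounds N =
     While (RLess (ROfNat (NVar ''T'')) (rounds_exp N)) (NAssign ''T'' (NConst 0) (NAdd (NVar ''T'') (NConst 1)))"

text \<open>The oracle reads a stored set, so element \<open>i\<close> is toggled in place and
  restored after each query.\<close>

definition add_marginals :: com where
  "add_marginals =
     Query ''x'' (NConst 0) (NAdd (NVar ''k'') (NConst 1)) ''A'' ;;
     NAssign ''A'' (NVar ''i'') (NConst 1) ;;
     Query ''y'' (NConst 0) (NAdd (NVar ''k'') (NConst 1)) ''A'' ;;
     NAssign ''A'' (NVar ''i'') (NConst 0) ;;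
     RAssign ''a'' (NConst 0) (RAdd (RVar ''a'') (RMul (RGet ''v'' (NVar ''k'')) (RSub (RVar ''y'') (RVar ''x'')))) ;;
     Query ''x'' (NConst 0) (NAdd (NVar ''k'') (NConst 1)) ''B'' ;;
     NAssign ''B'' (NVar ''i'') (NConst 0) ;;
     Query ''y'' (NConst 0) (NAdd (NVar ''k'') (NConst 1)) ''B'' ;;
     NAssign ''B'' (NVar ''i'') (NConst 1) ;;
     RAssign ''b'' (NConst 0) (RAdd (RVar ''b'') (RMul (RGet ''v'' (NVar ''k'')) (RSub (RVar ''y'') (RVar ''x''))))"

definition clipped_sub :: "vname \<Rightarrow> rexp \<Rightarrow> com" where
  "clipped_sub x e =
     RAssign x (NVar ''i'') (RSub (RGet x (NVar ''i'')) e) ;;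
     Cond (RLess (RGet x (NVar ''i'')) (RConst 0)) (RAssign x (NVar ''i'') (RConst 0)) Skip"

definition decide :: com where
  "decide =
     Cond (RLess (RAdd (RMul (RGet ''P'' (NVar ''i'')) (RSub (RVar ''a'') (RMul (RConst 3) (RVar ''b''))))
                       (RMul (RGet ''R'' (NVar ''i'')) (RSub (RMul (RConst 3) (RVar ''a'')) (RVar ''b''))))
                 (RConst 0))
       (NAssign ''B'' (NVar ''i'') (NConst 0) ;;
        clipped_sub ''P'' (RVar ''b'') ;;
        clipped_sub ''R'' (RSub (RVar ''b'') (RMul (RConst 2) (RVar ''a''))))
       (NAssign ''A'' (NVar ''i'') (NConst 1) ;;
        clipped_sub ''P'' (RSub (RVar ''a'') (RMul (RConst 2) (RVar ''b''))) ;;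
        clipped_sub ''R'' (RVar ''a''))"

definition greedy_step :: com where
  "greedy_step =
     RAssign ''a'' (NConst 0) (RConst 0) ;;
     RAssign ''b'' (NConst 0) (RConst 0) ;;
     For ''k'' ''n'' add_marginals ;;
     RAssign ''a'' (NConst 0) (RDiv (RVar ''a'') (RMul (RVar ''W'') (RVar ''c''))) ;;
     RAssign ''b'' (NConst 0) (RDiv (RVar ''b'') (RMul (RVar ''W'') (RVar ''c''))) ;;
     decide"

text \<open>The sets are reset in each call, but \<open>P\<close> and \<open>R\<close> are not:
  accumulating the deficits over the rounds is what replaces random choices.\<close>

definition double_greedy :: com where
  "double_greedy =
     For ''i'' ''m'' (NAssign ''A'' (NVar ''i'') (NConst 0) ;; NAssign ''B'' (NVar ''i'') (NConst 1)) ;;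
     RAssign ''W'' (NConst 0) (RConst 0) ;;
     For ''k'' ''n'' (RAssign ''W'' (NConst 0) (RAdd (RVar ''W'') (RGet ''v'' (NVar ''k'')))) ;;
     For ''i'' ''m'' greedy_step"

text \<open>The rule of \<open>multiplicative_weights\<close> with \<open>\<eta>\<close> = 1 / N and
  gains scaled by the width.\<close>

definition update_weights :: "nat \<Rightarrow> com" where
  "update_weights N =
     For ''k'' ''n''
       (Query ''x'' (NConst 0) (NAdd (NVar ''k'') (NConst 1)) ''A'' ;;
        RAssign ''v'' (NVar ''k'') (RMul (RGet ''v'' (NVar ''k''))
          (RSub (RConst 1) (RDiv (RVar ''x'') (RMul (RVar ''c'') (RConst N))))))"

text \<open>Integer registers cannot be multiplied, so the start of the current block is kept in
  \<open>p\<close> and advanced by \<open>m\<close>.\<close>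

definition copy_set :: com where
  "copy_set =
     For ''i'' ''m'' (NAssign ''X'' (NAdd (NVar ''p'') (NVar ''i'')) (NGet ''A'' (NVar ''i''))) ;;
     NAssign ''p'' (NConst 0) (NAdd (NVar ''p'') (NVar ''m''))"

text \<open>With h = N m + 1, the rounds share h / (h + m) equally and each of the \<open>m\<close>
  singletons gets 1 / (h + m), together less than 1 / N. The summand 1 avoids division by zero for
  \<open>m = 0\<close>.\<close>

definition round_weight :: "nat \<Rightarrow> rexp" where
  "round_weight N =
     (let h = RAdd (RMul (RConst N) (ROfNat (NVar ''m''))) (RConst 1)
      in RDiv h (RMul (ROfNat (NVar ''T'')) (RAdd h (ROfNat (NVar ''m'')))))"

definition singleton_weight :: "nat \<Rightarrow> rexp" where
  "singleton_weight N =
     RDiv (RConst 1) (RAdd (RAdd (RMul (RConst N) (ROfNat (NVar ''m''))) (RConst 1)) (ROfNat (NVar ''m'')))"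

definition play_round :: "nat \<Rightarrow> com" where
  "play_round N =
     double_greedy ;; update_weights N ;; copy_set ;;
     RAssign ''w'' (NVar ''t'') (round_weight N)"

text \<open>One entry per block suffices, because \<open>X\<close> is still 0 beyond the blocks of
  the rounds.\<close>

definition output_singletons :: "nat \<Rightarrow> com" where
  "output_singletons N =
     For ''i'' ''m''
       (NAssign ''X'' (NAdd (NVar ''p'') (NVar ''i'')) (NConst 1) ;;
        NAssign ''p'' (NConst 0) (NAdd (NVar ''p'') (NVar ''m'')) ;;
        RAssign ''w'' (NAdd (NVar ''T'') (NVar ''i'')) (singleton_weight N)) ;;
     NAssign ''S'' (NConst 0) (NAdd (NVar ''T'') (NVar ''m''))"

definition robust_program :: "nat \<Rightarrow> com" where
  "robust_program N =
     min_singleton_sums ;; init_weights N ;; compute_rounds N ;;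
     For ''t'' ''T'' (play_round N) ;; output_singletons N"

lemma mods [simp]:
  "nmod add_singleton = {''D''}" "rmod add_singleton = {''x'', ''g''}"
  "nmod min_singleton_sums = {''k'', ''i'', ''D''}" "rmod min_singleton_sums = {''x'', ''g'', ''z''}"
  "nmod (init_weights N) = {''k''}" "rmod (init_weights N) = {''c'', ''v''}"
  "nmod (compute_rounds N) = {''T''}" "rmod (compute_rounds N) = {}"
  "nmod add_marginals = {''A'', ''B''}" "rmod add_marginals = {''x'', ''y'', ''a'', ''b''}"
  "nmod (clipped_sub u e) = {}" "rmod (clipped_sub u e) = {u}"
  "nmod decide = {''A'', ''B''}" "rmod decide = {''P'', ''R''}"
  "nmod greedy_step = {''k'', ''A'', ''B''}" "rmod greedy_step = {''a'', ''b'', ''x'', ''y'', ''P'', ''R''}"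
  "nmod double_greedy = {''i'', ''k'', ''A'', ''B''}"
  "rmod double_greedy = {''W'', ''a'', ''b'', ''x'', ''y'', ''P'', ''R''}"
  "nmod (update_weights N) = {''k''}" "rmod (update_weights N) = {''x'', ''v''}"
  "nmod copy_set = {''i'', ''X'', ''p''}" "rmod copy_set = {}"
  "nmod (play_round N) = {''i'', ''k'', ''A'', ''B'', ''X'', ''p''}"
  "rmod (play_round N) = {''W'', ''a'', ''b'', ''x'', ''y'', ''P'', ''R'', ''v'', ''w''}"
  "nmod (output_singletons N) = {''i'', ''X'', ''p'', ''S''}" "rmod (output_singletons N) = {''w''}"
  by (auto simp: add_singleton_def min_singleton_sums_def init_weights_def compute_rounds_def
      add_marginals_def clipped_sub_def decide_def greedy_step_def double_greedy_def
      update_weights_def copy_set_def play_round_def output_singletons_def)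

section \<open>Correctness of the parts of the program\<close>

locale machine_run =
  fixes Q :: "nat \<Rightarrow> nat set \<Rightarrow> real" and m n N :: nat
begin

definition G :: "nat \<Rightarrow> nat set \<Rightarrow> real" where
  "G k Y = Q (Suc k) Y"

definition singleton_sum :: "nat \<Rightarrow> real" where
  "singleton_sum k = (\<Sum>i<m. G k {i})"

definition cap :: real where
  "cap = real N * real m * Min (singleton_sum ` {..<n})"

definition active :: "nat \<Rightarrow> bool" where
  "active k \<longleftrightarrow> singleton_sum k \<le> cap"

definition rounds :: nat where
  "rounds = N ^ 4 * (m + 1) ^ 6 * n"

lemma runs_min_singleton_sums:
  assumes s: "narr s ''m'' 0 = m" "narr s ''n'' 0 = n" "members ''D'' s = {}" "rarr s ''g'' = (\<lambda>_. 0)"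
    and n: "n \<ge> 1"
  shows "runs Q min_singleton_sums s (n * (m * 6 + 6) + 2)
    (\<lambda>s. (\<forall>k<n. rarr s ''g'' k = singleton_sum k) \<and> rarr s ''z'' 0 = Min (singleton_sum ` {..<n}))"
proof -
  let ?sum = "For ''i'' ''m'' add_singleton"
  let ?min = "Cond (BAnd (NLess (NConst 0) (NVar ''k'')) (BNot (RLess (RGet ''g'' (NVar ''k'')) (RVar ''z''))))
          Skip (RAssign ''z'' (NConst 0) (RGet ''g'' (NVar ''k'')))"
  define I where "I = (\<lambda>k (s::store). (\<forall>l. rarr s ''g'' l = (if l < k then singleton_sum l else 0)) \<and>
      (k > 0 \<longrightarrow> rarr s ''z'' 0 = Min (singleton_sum ` {..<k})) \<and> members ''D'' s = {})"
  have "runs Q min_singleton_sums s (n * ((m * 6 + 4) + 2) + 2) (I n)"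
    unfolding min_singleton_sums_def
  proof (rule runs_For)
    show "I 0 s" using s by (simp add: I_def)
  next
    fix k s' assume k: "k < n" "narr s' ''k'' 0 = k" and I: "I k s'"
      and a: "agree (For ''k'' ''n'' (?sum ;; ?min)) s s'"
    have m: "narr s' ''m'' 0 = m" using s agree_narr[OF a] by simp
    define J where "J = (\<lambda>i (t::store). rarr t ''g'' = (rarr s' ''g'')(k := \<Sum>j<i. G k {j}) \<and> members ''D'' t = {})"
    have "runs Q ?sum s' (m * (4 + 2) + 2) (J m)"
    proof (rule runs_For)
      show "J 0 s'" using I by (auto simp: J_def I_def)
    next
      fix i t assume i: "i < m" "narr t ''i'' 0 = i" and J: "J i t"
        and b: "agree ?sum s' t"
      have "narr t ''k'' 0 = k" using k agree_narr[OF b] by simp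
      then show "runs Q add_singleton t 4 (J (Suc i))"
        using i J by (intro runs_straight_line) (auto simp: add_singleton_def J_def G_def add.commute fun_eq_iff)
    qed (use m in \<open>auto simp: J_def\<close>)
    then show "runs Q (?sum ;; ?min) s' (m * 6 + 4) (I (Suc k))"
    proof (rule runs_weaken[OF runs_Seq])
      fix t assume b: "agree ?sum s' t" and J: "J m t"
      have "narr t ''k'' 0 = k" "rarr t ''z'' = rarr s' ''z''"
        using k agree_narr[OF b] agree_rarr[OF b] by auto
      moreover have "Min (singleton_sum ` {..<Suc k}) = min (singleton_sum k) (Min (singleton_sum ` {..<k}))" if "k > 0"
        using that by (simp add: lessThan_Suc lessThan_empty_iff)
      ultimately show "runs Q (?min) t 2 (I (Suc k))"
        using I J by (intro runs_straight_line)
          (auto simp: I_def J_def min_def singleton_sum_def[symmetric] lessThan_Suc less_Suc_eq)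
    qed auto
  qed (use s in \<open>auto simp: I_def\<close>)
  then show ?thesis
    by (rule runs_weaken) (use n in \<open>auto simp: I_def\<close>)
qed

lemma runs_init_weights:
  assumes s: "narr s ''m'' 0 = m" "narr s ''n'' 0 = n"
    "\<And>k. k < n \<Longrightarrow> rarr s ''g'' k = singleton_sum k" "rarr s ''z'' 0 = Min (singleton_sum ` {..<n})"
  shows "runs Q (init_weights N) s (n * 4 + 3)
    (\<lambda>s. rarr s ''c'' 0 = cap \<and> (\<forall>k<n. rarr s ''v'' k = (if active k then 1 else 0)))"
proof -
  let ?c = "RAssign ''c'' (NConst 0) (RMul (RMul (RConst N) (ROfNat (NVar ''m''))) (RVar ''z''))"
  let ?d = "Cond (RLess (RVar ''c'') (RGet ''g'' (NVar ''k'')))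
         (RAssign ''v'' (NVar ''k'') (RConst 0)) (RAssign ''v'' (NVar ''k'') (RConst 1))"
  define I where "I = (\<lambda>k (s::store). rarr s ''c'' 0 = cap \<and> (\<forall>l<k. rarr s ''v'' l = (if active l then 1 else 0)))"
  have "runs Q (init_weights N) s (1 + (n * (2 + 2) + 2)) (I n)"
    unfolding init_weights_def
  proof (rule runs_Seq)
    show "runs Q ?c s 1 (\<lambda>s. rarr s ''c'' 0 = cap)"
      using s by (intro runs_straight_line) (auto simp: cap_def)
  next
    fix t assume a: "agree ?c s t" and c: "rarr t ''c'' 0 = cap"
    show "runs Q (For ''k'' ''n'' ?d) t (n * (2 + 2) + 2) (I n)"
    proof (rule runs_For)
      fix k u assume k: "k < n" "narr u ''k'' 0 = k" and I: "I k u" and b: "agree (For ''k'' ''n'' ?d) t u"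
      have "rarr u ''g'' k = singleton_sum k"
        using agree_rarr[OF b] agree_rarr[OF a] s k by simp
      then show "runs Q ?d u 2 (I (Suc k))"
        using I k by (intro runs_straight_line) (auto simp: I_def active_def less_Suc_eq)
    qed (use c s agree_narr[OF a] in \<open>auto simp: I_def\<close>)
  qed
  then show ?thesis by (rule runs_weaken) (auto simp: I_def)
qed

lemma runs_compute_rounds:
  assumes s: "narr s ''m'' 0 = m" "narr s ''n'' 0 = n" "narr s ''T'' 0 = 0"
  shows "runs Q (compute_rounds N) s (rounds * 2 + 1) (\<lambda>s. narr s ''T'' 0 = rounds)"
proof -
  define I where "I = (\<lambda>j (s::store). narr s ''m'' 0 = m \<and> narr s ''n'' 0 = n \<and> narr s ''T'' 0 = j)"
  have h: "h ^ 6 = (h * h) * ((h * h) * (h * h))" for h :: nat by (simp add: power_numeral_reduce)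
  have e: "rval (rounds_exp N) s = real rounds" if "narr s ''m'' 0 = m" "narr s ''n'' 0 = n" for s
    using that unfolding rounds_exp_def rounds_def Let_def h
    by (simp only: nval.simps rval.simps of_nat_mult)
  have "runs Q (compute_rounds N) s (rounds * Suc 1 + 1) (I rounds)"
    unfolding compute_rounds_def
    by (rule runs_While) (use s e in \<open>auto simp: I_def intro!: runs_straight_line\<close>)
  then show ?thesis by (rule runs_weaken) (auto simp: I_def)
qed

definition wavg :: "(nat \<Rightarrow> real) \<Rightarrow> real \<Rightarrow> nat set \<Rightarrow> real" where
  "wavg v c Y = (\<Sum>k<n. v k * G k Y) / ((\<Sum>k<n. v k) * c)"

lemma runs_marginals:
  assumes s: "narr s ''n'' 0 = n" "narr s ''i'' 0 = i" "i \<notin> members ''A'' s" "i \<in> members ''B'' s"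
    and v: "\<And>k. k < n \<Longrightarrow> rarr s ''v'' k = v k" and ab: "rarr s ''a'' 0 = 0" "rarr s ''b'' 0 = 0"
  shows "runs Q (For ''k'' ''n'' add_marginals) s (n * 12 + 2)
    (\<lambda>t. members ''A'' t = members ''A'' s \<and> members ''B'' t = members ''B'' s \<and>
      rarr t ''a'' 0 = (\<Sum>k<n. v k * (G k (insert i (members ''A'' s)) - G k (members ''A'' s))) \<and>
      rarr t ''b'' 0 = (\<Sum>k<n. v k * (G k (members ''B'' s - {i}) - G k (members ''B'' s))))"
proof -
  define I where "I = (\<lambda>j t. members ''A'' t = members ''A'' s \<and> members ''B'' t = members ''B'' s \<and>
      rarr t ''a'' 0 = (\<Sum>k<j. v k * (G k (insert i (members ''A'' s)) - G k (members ''A'' s))) \<and>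
      rarr t ''b'' 0 = (\<Sum>k<j. v k * (G k (members ''B'' s - {i}) - G k (members ''B'' s))))"
  have "runs Q (For ''k'' ''n'' add_marginals) s (n * (10 + 2) + 2) (I n)"
  proof (rule runs_For)
    fix k t assume k: "k < n" "narr t ''k'' 0 = k" and I: "I k t"
      and a: "agree (For ''k'' ''n'' add_marginals) s t"
    have "narr t ''i'' 0 = i" "rarr t ''v'' k = v k"
      using agree_narr[OF a] agree_rarr[OF a] s v k by auto
    then show "runs Q add_marginals t 10 (I (Suc k))"
      using k I s by (intro runs_straight_line)
        (auto simp: add_marginals_def I_def G_def insert_absorb)
  qed (use s ab in \<open>auto simp: I_def\<close>)
  then show ?thesis by (rule runs_weaken) (auto simp: I_def)
qed

lemma runs_greedy_step:
  fixes s :: store and i :: nat and v :: "nat \<Rightarrow> real" and c :: real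
  defines "F \<equiv> wavg v c" and "A \<equiv> members ''A'' s" and "B \<equiv> members ''B'' s"
    and "P \<equiv> rarr s ''P''" and "R \<equiv> rarr s ''R''"
  defines "a \<equiv> F (insert i A) - F A" and "b \<equiv> F (B - {i}) - F B"
  assumes s: "narr s ''n'' 0 = n" "narr s ''i'' 0 = i" and AB: "i \<notin> A" "i \<in> B"
    and v: "\<And>k. k < n \<Longrightarrow> rarr s ''v'' k = v k"
    and W: "rarr s ''W'' 0 = (\<Sum>k<n. v k)" and c: "rarr s ''c'' 0 = c"
  shows "runs Q greedy_step s (n * 12 + 15)
    (\<lambda>t. if balance (P i) (R i) a b
      then members ''A'' t = insert i A \<and> members ''B'' t = B \<and>
        rarr t ''P'' = P(i := max 0 (P i - (a - 2 * b))) \<and> rarr t ''R'' = R(i := max 0 (R i - a))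
      else members ''A'' t = A \<and> members ''B'' t = B - {i} \<and>
        rarr t ''P'' = P(i := max 0 (P i - b)) \<and> rarr t ''R'' = R(i := max 0 (R i - (b - 2 * a))))"
    (is "runs Q _ s _ ?post")
proof -
  let ?a = "\<Sum>k<n. v k * (G k (insert i A) - G k A)" and ?b = "\<Sum>k<n. v k * (G k (B - {i}) - G k B)"
  let ?init = "\<lambda>x. RAssign x (NConst 0) (RConst 0)"
  let ?div = "\<lambda>x. RAssign x (NConst 0) (RDiv (RVar x) (RMul (RVar ''W'') (RVar ''c'')))"
  define s1 where "s1 = rupd ''b'' 0 0 (rupd ''a'' 0 0 s)"
  \<comment> \<open>The program divides after summing; by linearity the results are the marginals of
    the averaged function.\<close>
  have ab: "a = ?a / ((\<Sum>k<n. v k) * c)" "b = ?b / ((\<Sum>k<n. v k) * c)"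
    by (simp_all add: a_def b_def F_def wavg_def sum_subtractf right_diff_distrib diff_divide_distrib)
  have loop: "runs Q (For ''k'' ''n'' add_marginals) s1 (n * 12 + 2)
    (\<lambda>t. members ''A'' t = A \<and> members ''B'' t = B \<and> rarr t ''a'' 0 = ?a \<and> rarr t ''b'' 0 = ?b)"
    using runs_marginals[of s1 i] s AB v by (simp add: s1_def A_def B_def)
  have "runs Q greedy_step s (1 + (1 + ((n * 12 + 2) + 11))) ?post"
    unfolding greedy_step_def
  proof (rule runs_Seq[where R = "\<lambda>t. t = rupd ''a'' 0 0 s"], goal_cases)
    case init: (2 s')
    show ?case
    proof (rule runs_Seq[where R = "\<lambda>t. t = s1"], goal_cases)
      case (2 t)
      show ?case unfolding 2
      proof (rule runs_Seq[OF loop])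
        fix t assume ag: "agree (For ''k'' ''n'' add_marginals) s1 t"
          and t: "members ''A'' t = A \<and> members ''B'' t = B \<and> rarr t ''a'' 0 = ?a \<and> rarr t ''b'' 0 = ?b"
        have "narr t ''i'' 0 = i" "rarr t ''P'' = P" "rarr t ''R'' = R" "rarr t ''W'' 0 = (\<Sum>k<n. v k)"
          "rarr t ''c'' 0 = c"
          using agree_narr[OF ag] agree_rarr[OF ag] s W c by (auto simp: s1_def P_def R_def)
        then show "runs Q (?div ''a'' ;; ?div ''b'' ;; decide) t 11 ?post"
          using t AB by (intro runs_straight_line)
            (auto simp: decide_def clipped_sub_def balance_def max_def fun_eq_iff insert_absorb
              simp flip: ab)
      qed
    qed (use init in \<open>auto simp: s1_def intro: runs_straight_line\<close>)
  qed (auto intro: runs_straight_line)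
  then show ?thesis by (simp add: add.commute)
qed

lemma runs_double_greedy:
  fixes v :: "nat \<Rightarrow> real" and c :: real
  defines "F \<equiv> wavg v c"
  assumes s: "narr s ''m'' 0 = m" "narr s ''n'' 0 = n" "\<And>j. 0 \<le> rarr s ''P'' j \<and> 0 \<le> rarr s ''R'' j"
      "members ''A'' s \<subseteq> {..<m}" "members ''B'' s \<subseteq> {..<m}"
    and v: "\<And>k. k < n \<Longrightarrow> rarr s ''v'' k = v k" and c: "rarr s ''c'' 0 = c"
    and F: "submodular_on {..<m} F" "\<And>Y. Y \<subseteq> {..<m} \<Longrightarrow> 0 \<le> F Y \<and> F Y \<le> 1" "F {} = 0"
  shows "runs Q double_greedy s (12 * m * n + 21 * m + 3 * n + 7)
    (\<lambda>t. members ''B'' t = members ''A'' t \<and>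
      greedy_inv m F (rarr s ''P'') (rarr s ''R'') m (members ''A'' t) (members ''A'' t)
        (rarr t ''P'') (rarr t ''R''))"
proof -
  let ?reset = "NAssign ''A'' (NVar ''i'') (NConst 0) ;; NAssign ''B'' (NVar ''i'') (NConst 1)"
  let ?W0 = "RAssign ''W'' (NConst 0) (RConst 0)"
  let ?addW = "RAssign ''W'' (NConst 0) (RAdd (RVar ''W'') (RGet ''v'' (NVar ''k'')))"
  let ?inv = "greedy_inv m F (rarr s ''P'') (rarr s ''R'')"
  define I where "I = (\<lambda>j t. (\<forall>i<j. i \<notin> members ''A'' t \<and> i \<in> members ''B'' t) \<and>
      members ''A'' t \<subseteq> {..<m} \<and> members ''B'' t \<subseteq> {..<m})"
  have 1: "runs Q (For ''i'' ''m'' ?reset) s (m * (2 + 2) + 2) (I m)"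
  proof (rule runs_For)
    fix i t assume "i < m" "narr t ''i'' 0 = i" "I i t"
    then show "runs Q ?reset t 2 (I (Suc i))"
      by (intro runs_straight_line) (auto simp: I_def less_Suc_eq)
  qed (use s in \<open>auto simp: I_def\<close>)
  have 3: "runs Q (For ''k'' ''n'' ?addW) t (n * (1 + 2) + 2) (\<lambda>t. rarr t ''W'' 0 = (\<Sum>k<n. v k))"
    if "agree (For ''i'' ''m'' ?reset ;; ?W0) s t" "rarr t ''W'' 0 = 0" for t
  proof (rule runs_For[where I = "\<lambda>j t. rarr t ''W'' 0 = (\<Sum>k<j. v k)"])
    fix k u assume k: "k < n" "narr u ''k'' 0 = k" "rarr u ''W'' 0 = (\<Sum>k<k. v k)"
      and a: "agree (For ''k'' ''n'' ?addW) t u"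
    have "rarr u ''v'' k = v k"
      using agree_rarr[OF a] agree_rarr[OF that(1)] v k by simp
    then show "runs Q ?addW u 1 (\<lambda>t. rarr t ''W'' 0 = (\<Sum>k<Suc k. v k))"
      using k by (intro runs_straight_line) auto
  qed (use that s agree_narr[OF that(1)] in auto)
  have 4: "runs Q (For ''i'' ''m'' greedy_step) t (m * ((n * 12 + 15) + 2) + 2)
      (\<lambda>t. ?inv m (members ''A'' t) (members ''B'' t) (rarr t ''P'') (rarr t ''R''))"
    if a: "agree (For ''i'' ''m'' ?reset ;; ?W0 ;; For ''k'' ''n'' ?addW) s t"
      and t: "rarr t ''W'' 0 = (\<Sum>k<n. v k)" "members ''A'' t = {}" "members ''B'' t = {..<m}" for t
  proof (rule runs_For[where
        I = "\<lambda>i t. ?inv i (members ''A'' t) (members ''B'' t) (rarr t ''P'') (rarr t ''R'')"])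
    \<comment> \<open>Before the first decision the modified optimum is \<open>Z\<close> itself, and
      \<open>F {} = 0\<close> turns the loss bound into 0 = 0.\<close>
    show "?inv 0 (members ''A'' t) (members ''B'' t) (rarr t ''P'') (rarr t ''R'')"
      using t s agree_rarr[OF a] F(3) by (auto simp: greedy_inv_def lessThan_atLeast0 Int_absorb2)
  next
    fix i u assume i: "i < m" "narr u ''i'' 0 = i"
      and inv: "?inv i (members ''A'' u) (members ''B'' u) (rarr u ''P'') (rarr u ''R'')"
      and b: "agree (For ''i'' ''m'' greedy_step) t u"
    have "i \<notin> members ''A'' u" "i \<in> members ''B'' u" using inv i by (auto simp: greedy_inv_def)
    moreover have "narr u ''n'' 0 = n" using s agree_narr[OF b] agree_narr[OF a] by simp
    moreover have "rarr u ''W'' 0 = (\<Sum>k<n. v k)" "rarr u ''c'' 0 = c" "\<And>k. k < n \<Longrightarrow> rarr u ''v'' k = v k"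
      using t c v agree_rarr[OF b] agree_rarr[OF a] by auto
    ultimately show "runs Q greedy_step u (n * 12 + 15)
        (\<lambda>t. ?inv (Suc i) (members ''A'' t) (members ''B'' t) (rarr t ''P'') (rarr t ''R''))"
      using greedy_inv_step[OF F(1,2) i(1) inv refl refl] i
      by (intro runs_weaken[OF runs_greedy_step[of u i v c, folded F_def]]) (auto split: if_splits)
  qed (use s agree_narr[OF a] in auto)
  have "runs Q double_greedy s
      ((m * (2 + 2) + 2) + (1 + ((n * (1 + 2) + 2) + (m * ((n * 12 + 15) + 2) + 2))))
      (\<lambda>t. ?inv m (members ''A'' t) (members ''B'' t) (rarr t ''P'') (rarr t ''R''))"
    unfolding double_greedy_def
  proof (rule runs_Seq[OF 1], goal_cases)
    case A: (1 s1)
    show ?case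
    proof (rule runs_Seq[where R = "\<lambda>t. t = rupd ''W'' 0 0 s1"], goal_cases)
      case (2 s2)
      have AB: "members ''A'' s1 = {}" "members ''B'' s1 = {..<m}"
        using A(2) by (auto simp: I_def)
      have "agree (For ''i'' ''m'' ?reset ;; ?W0) s s2"
        using A 2 by (auto simp: agree_def)
      note 3 = 3[OF this]
      show ?case
      proof (rule runs_Seq, rule 3, goal_cases)
        case B: (2 s3)
        have "agree (For ''i'' ''m'' ?reset ;; ?W0 ;; For ''k'' ''n'' ?addW) s s3"
          using A 2 B by (auto simp: agree_def)
        moreover have "members ''A'' s3 = {}" "members ''B'' s3 = {..<m}"
          using AB 2 agree_members[OF B(1)] by auto
        ultimately show ?case using B by (intro 4)
      qed (use 2 in auto)
    qed (auto intro: runs_straight_line)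
  qed
  then show ?thesis
  proof (rule runs_weaken, goal_cases)
    case (2 t)
    \<comment> \<open>After \<open>m\<close> decisions the undecided part \<open>{m..<m}\<close> is
      empty.\<close>
    then have "members ''B'' t = members ''A'' t" by (simp add: greedy_inv_def)
    with 2 show ?case by simp
  qed (simp add: algebra_simps)
qed

end

lemma submodular_on_sum:
  assumes "\<And>k. k \<in> K \<Longrightarrow> submodular_on E (F k)" "\<And>k. k \<in> K \<Longrightarrow> 0 \<le> a k"
  shows "submodular_on E (\<lambda>Y. \<Sum>k\<in>K. a k * F k Y)"
  unfolding submodular_on_def
proof (intro allI impI)
  fix X Y assume XY: "X \<subseteq> E" "Y \<subseteq> E"
  have "a k * F k (X \<union> Y) + a k * F k (X \<inter> Y) \<le> a k * F k X + a k * F k Y" if "k \<in> K" for k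
    using mult_left_mono[OF submodular_onD[OF assms(1)[OF that] XY] assms(2)[OF that]]
    by (simp add: algebra_simps)
  then show "(\<Sum>k\<in>K. a k * F k (X \<union> Y)) + (\<Sum>k\<in>K. a k * F k (X \<inter> Y))
      \<le> (\<Sum>k\<in>K. a k * F k X) + (\<Sum>k\<in>K. a k * F k Y)"
    by (simp add: sum_mono flip: sum.distrib)
qed

text \<open>The error budget for \<open>x\<close> = 1 / N: \<open>1 + x\<close> pays for mixing in
  the singletons, \<open>1 + 2 * x\<close> for multiplicative weights, and \<open>2 * x\<close> for
  the greedy deficits and the additive term of the weights.\<close>

lemma ratio_bound:
  fixes x \<epsilon> :: real
  assumes "0 \<le> x" "4 * x \<le> \<epsilon>" "\<epsilon> \<le> 1/2"
  shows "(1/2 - \<epsilon>) * (1 + x) * (1 + 2 * x) \<le> 1/2 - 2 * x"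
proof -
  have "(1/2 - \<epsilon>) * ((1 + x) * (1 + 2 * x)) \<le> (1/2 - 4 * x) * ((1 + x) * (1 + 2 * x))"
    using assms by (intro mult_right_mono) auto
  also have "\<dots> = 1/2 - 2 * x - (x / 2 + 11 * (x * x) + 8 * (x * x * x))"
    by (simp add: algebra_simps)
  also have "\<dots> \<le> 1/2 - 2 * x"
    using assms(1) mult_nonneg_nonneg[of x x] mult_nonneg_nonneg[of "x * x" x] by linarith
  finally show ?thesis by (simp add: mult.assoc)
qed

text \<open>Keeps the blocks of length \<open>m\<close> in the array \<open>X\<close> apart.\<close>

lemma block_less:
  fixes \<tau> t j m :: nat
  shows "\<tau> < t \<Longrightarrow> j < m \<Longrightarrow> \<tau> * m + j < t * m"
  by (metis add.commute add_less_cancel_left less_le_trans mult.commute mult_Suc_right mult_le_mono2 Suc_leI)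

section \<open>Invariants across the rounds\<close>

locale robust_run = machine_run +
  assumes n_pos: "n \<ge> 1" and N_ge: "N \<ge> 2"
    and sub: "\<And>k. k < n \<Longrightarrow> submodular_on {..<m} (G k)"
    and nonneg: "\<And>k Y. k < n \<Longrightarrow> Y \<subseteq> {..<m} \<Longrightarrow> 0 \<le> G k Y"
    and empty: "\<And>k. k < n \<Longrightarrow> G k {} = 0"
begin

definition gain :: "(nat \<Rightarrow> nat set) \<Rightarrow> nat \<Rightarrow> nat \<Rightarrow> real" where
  "gain Ss k t = G k (Ss t) / cap"

definition weight :: "(nat \<Rightarrow> nat set) \<Rightarrow> nat \<Rightarrow> nat \<Rightarrow> real" where
  "weight Ss t k = (if active k then \<Prod>\<tau><t. 1 - 1 / real N * gain Ss k \<tau> else 0)"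

definition objective :: "(nat \<Rightarrow> nat set) \<Rightarrow> nat \<Rightarrow> nat set \<Rightarrow> real" where
  "objective Ss t = wavg (weight Ss t) cap"

lemma G_le: "k < n \<Longrightarrow> Y \<subseteq> {..<m} \<Longrightarrow> G k Y \<le> singleton_sum k"
  unfolding singleton_sum_def using sub nonneg empty by (intro submodular_le_sum_singletons) auto

lemma singleton_sum_nonneg: "k < n \<Longrightarrow> 0 \<le> singleton_sum k"
  unfolding singleton_sum_def using nonneg by (intro sum_nonneg) auto

lemma cap_nonneg: "0 \<le> cap"
proof -
  have "0 \<le> Min (singleton_sum ` {..<n})"
    using n_pos singleton_sum_nonneg by (subst Min_ge_iff) (auto simp: lessThan_empty_iff)
  then show ?thesis by (simp add: cap_def)
qed

lemma gain_bounds: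
  assumes "k < n" "active k" "Ss t \<subseteq> {..<m}"
  shows "0 \<le> gain Ss k t \<and> gain Ss k t \<le> 1"
proof -
  have "0 \<le> G k (Ss t)" "G k (Ss t) \<le> cap"
    using assms nonneg G_le[of k "Ss t"] by (auto simp: active_def)
  then show ?thesis using cap_nonneg by (auto simp: gain_def divide_le_eq_1)
qed

lemma weight_nonneg:
  assumes "k < n" "\<And>\<tau>. \<tau> < t \<Longrightarrow> Ss \<tau> \<subseteq> {..<m}"
  shows "0 \<le> weight Ss t k"
proof -
  have "0 \<le> 1 - 1 / real N * gain Ss k \<tau>" if "active k" "\<tau> < t" for \<tau>
    using gain_bounds[of k Ss \<tau>] assms that N_ge
    by (simp add: divide_le_eq)
  then show ?thesis by (auto simp: weight_def intro!: prod_nonneg)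
qed

lemma weight_Suc: "weight Ss (Suc t) k = weight Ss t k * (1 - G k (Ss t) / (cap * real N))"
  by (simp add: weight_def gain_def)

text \<open>The weights of round \<open>t\<close> depend only on earlier sets. Hence a run can be
  extended to \<open>Ss(t := S)\<close> without changing the objectives up to round
  \<open>t\<close>.\<close>

lemma weight_cong: "(\<And>\<tau>. \<tau> < t \<Longrightarrow> Ss \<tau> = Ss' \<tau>) \<Longrightarrow> weight Ss t = weight Ss' t"
  by (auto simp: weight_def gain_def fun_eq_iff intro!: prod.cong)

lemma objective_cong: "(\<And>\<tau>. \<tau> < t \<Longrightarrow> Ss \<tau> = Ss' \<tau>) \<Longrightarrow> objective Ss t = objective Ss' t"
  unfolding objective_def by (simp add: weight_cong[of t Ss Ss'])

text \<open>Inactive functions have weight 0 and active ones are at most \<open>cap\<close> by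
  \<open>G_le\<close>, so the scaled average stays in the unit interval. With a zero denominator the
  average is 0 and the claims still hold.\<close>

lemma objective_props:
  assumes "\<And>\<tau>. \<tau> < t \<Longrightarrow> Ss \<tau> \<subseteq> {..<m}"
  shows "submodular_on {..<m} (objective Ss t)"
    and "Y \<subseteq> {..<m} \<Longrightarrow> 0 \<le> objective Ss t Y \<and> objective Ss t Y \<le> 1"
    and "objective Ss t {} = 0"
proof -
  let ?W = "\<Sum>k<n. weight Ss t k"
  have w: "0 \<le> weight Ss t k" if "k < n" for k
    using weight_nonneg[OF that] assms by blast
  have W: "0 \<le> ?W * cap" using w cap_nonneg by (auto intro!: mult_nonneg_nonneg sum_nonneg)
  have e: "objective Ss t = (\<lambda>Y. \<Sum>k<n. weight Ss t k / (?W * cap) * G k Y)"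
    by (simp add: objective_def wavg_def fun_eq_iff sum_divide_distrib)
  show "submodular_on {..<m} (objective Ss t)"
    unfolding e using w W sub by (intro submodular_on_sum) auto
  show "objective Ss t {} = 0" using empty by (simp add: e)
  show "0 \<le> objective Ss t Y \<and> objective Ss t Y \<le> 1" if Y: "Y \<subseteq> {..<m}"
  proof
    show "0 \<le> objective Ss t Y" unfolding e
      using w W nonneg Y by (intro sum_nonneg mult_nonneg_nonneg[OF divide_nonneg_nonneg]) auto
    have "(\<Sum>k<n. weight Ss t k * G k Y) \<le> (\<Sum>k<n. weight Ss t k * cap)"
    proof (intro sum_mono)
      fix k assume "k \<in> {..<n}"
      then show "weight Ss t k * G k Y \<le> weight Ss t k * cap"
        using w[of k] G_le[of k Y] Y
        by (cases "active k") (auto simp: active_def weight_def intro!: mult_left_mono)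
    qed
    then show "objective Ss t Y \<le> 1"
      using W by (auto simp: objective_def wavg_def divide_le_eq_1 sum_distrib_right less_le)
  qed
qed

definition round_share :: real where
  "round_share = (real N * real m + 1) / (real rounds * (real N * real m + 1 + real m))"

definition singleton_share :: real where
  "singleton_share = 1 / (real N * real m + 1 + real m)"

text \<open>If \<open>cap = 0\<close>, then every \<open>objective\<close> is 0 because of division by zero, and the invariant holds
  trivially.\<close>

definition run_inv :: "(nat \<Rightarrow> nat set) \<Rightarrow> nat \<Rightarrow> (nat \<Rightarrow> real) \<Rightarrow> (nat \<Rightarrow> real) \<Rightarrow> bool" where
  "run_inv Ss t P R \<longleftrightarrow>
     (\<forall>\<tau>. Ss \<tau> \<subseteq> {..<m}) \<and> (\<forall>j. 0 \<le> P j \<and> 0 \<le> R j) \<and>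
     (\<forall>j<m. (P j)\<^sup>2 + (R j)\<^sup>2 \<le> 10 * real t) \<and>
     (\<forall>Z\<subseteq>{..<m}. (\<Sum>\<tau><t. 2 * objective Ss \<tau> Z - 4 * objective Ss \<tau> (Ss \<tau>))
        \<le> (\<Sum>j<m. if j \<in> Z then R j else P j))"

text \<open>At the end of a round the modified optimum is \<open>S\<close>, so the greedy bound
  reads 2 F(Z) - 4 F(S) + F({..<m}) for the current objective F. The last term is nonnegative and is
  dropped; the changes of the deficits telescope.\<close>

lemma run_inv_step:
  assumes inv: "run_inv Ss t P R" and g: "greedy_inv m (objective Ss t) P R m S S P' R'"
  shows "run_inv (Ss(t := S)) (Suc t) P' R'"
proof -
  let ?Ss = "Ss(t := S)"
  have S: "S \<subseteq> {..<m}" and p: "\<forall>j. 0 \<le> P' j \<and> 0 \<le> R' j"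
    and q: "\<And>j. j < m \<Longrightarrow> (P' j)\<^sup>2 + (R' j)\<^sup>2 \<le> (P j)\<^sup>2 + (R j)\<^sup>2 + 10"
    and l: "\<And>Z. Z \<subseteq> {..<m} \<Longrightarrow> 2 * (objective Ss t Z - objective Ss t ((Z \<union> S) \<inter> S)) -
        (objective Ss t S + objective Ss t S - objective Ss t {..<m})
        \<le> (\<Sum>j<m. if j \<in> Z then R' j - R j else P' j - P j)"
    using g unfolding greedy_inv_def by blast+
  have Ss: "\<And>\<tau>. Ss \<tau> \<subseteq> {..<m}" and q': "\<And>j. j < m \<Longrightarrow> (P j)\<^sup>2 + (R j)\<^sup>2 \<le> 10 * real t"
    and l': "\<And>Z. Z \<subseteq> {..<m} \<Longrightarrow> (\<Sum>\<tau><t. 2 * objective Ss \<tau> Z - 4 * objective Ss \<tau> (Ss \<tau>))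
        \<le> (\<Sum>j<m. if j \<in> Z then R j else P j)"
    using inv unfolding run_inv_def by blast+
  have o: "objective ?Ss \<tau> = objective Ss \<tau>" if "\<tau> \<le> t" for \<tau>
    using that by (intro objective_cong) auto
  have "(\<Sum>\<tau><Suc t. 2 * objective ?Ss \<tau> Z - 4 * objective ?Ss \<tau> (?Ss \<tau>))
      \<le> (\<Sum>j<m. if j \<in> Z then R' j else P' j)" if Z: "Z \<subseteq> {..<m}" for Z
  proof -
    have "(\<Sum>\<tau><Suc t. 2 * objective ?Ss \<tau> Z - 4 * objective ?Ss \<tau> (?Ss \<tau>)) =
        (\<Sum>\<tau><t. 2 * objective Ss \<tau> Z - 4 * objective Ss \<tau> (Ss \<tau>)) + (2 * objective Ss t Z - 4 * objective Ss t S)"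
      by (simp add: o)
    also have "(2 * objective Ss t Z - 4 * objective Ss t S)
        \<le> (\<Sum>j<m. if j \<in> Z then R' j - R j else P' j - P j)"
    proof -
      have "(Z \<union> S) \<inter> S = S" by blast
      moreover have "0 \<le> objective Ss t {..<m}"
        using objective_props(2)[of t Ss "{..<m}"] Ss by simp
      ultimately show ?thesis using l[OF Z] by simp
    qed
    also note l'[OF Z]
    also have "(\<Sum>j<m. if j \<in> Z then R j else P j) + (\<Sum>j<m. if j \<in> Z then R' j - R j else P' j - P j)
        = (\<Sum>j<m. if j \<in> Z then R' j else P' j)"
      unfolding sum.distrib[symmetric] by (intro sum.cong) auto
    finally show ?thesis by simp
  qed
  moreover have "(P' j)\<^sup>2 + (R' j)\<^sup>2 \<le> 10 * real (Suc t)" if "j < m" for j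
    using q[OF that] q'[OF that] by simp
  ultimately show ?thesis
    using S p Ss by (auto simp: run_inv_def less_Suc_eq)
qed

lemma runs_update_weights:
  assumes s: "narr s ''n'' 0 = n" "rarr s ''c'' 0 = cap" "members ''A'' s = Ss t"
    and v: "\<And>k. k < n \<Longrightarrow> rarr s ''v'' k = weight Ss t k"
  shows "runs Q (update_weights N) s (n * 4 + 2) (\<lambda>u. \<forall>k<n. rarr u ''v'' k = weight Ss (Suc t) k)"
proof -
  define I where "I = (\<lambda>j (u::store). \<forall>k<n. rarr u ''v'' k = weight Ss (if k < j then Suc t else t) k)"
  have "runs Q (update_weights N) s (n * (2 + 2) + 2) (I n)"
    unfolding update_weights_def
  proof (rule runs_For, goal_cases)
    case (7 k u)
    note a = this(2)
    have "members ''A'' u = Ss t" "rarr u ''c'' 0 = cap"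
      using s agree_members[OF a] agree_rarr[OF a] by auto
    then show ?case using 7
      by (intro runs_straight_line) (auto simp: I_def weight_Suc G_def less_Suc_eq)
  qed (use s v in \<open>auto simp: I_def\<close>)
  then show ?thesis by (rule runs_weaken) (auto simp: I_def)
qed

lemma runs_copy_set:
  assumes s: "narr s ''m'' 0 = m" "narr s ''p'' 0 = p"
  shows "runs Q copy_set s (m * 3 + 3)
    (\<lambda>u. narr u ''p'' 0 = p + m \<and>
      (\<forall>x. narr u ''X'' x = (if p \<le> x \<and> x < p + m then narr s ''A'' (x - p) else narr s ''X'' x)))"
proof -
  let ?c = "NAssign ''X'' (NAdd (NVar ''p'') (NVar ''i'')) (NGet ''A'' (NVar ''i''))"
  define I where "I = (\<lambda>j (u::store). \<forall>x. narr u ''X'' x = (if p \<le> x \<and> x < p + j then narr s ''A'' (x - p) else narr s ''X'' x))"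
  have "runs Q (For ''i'' ''m'' ?c) s (m * (1 + 2) + 2) (I m)"
  proof (rule runs_For, goal_cases)
    case (7 i u)
    note a = this(2)
    have "narr u ''A'' = narr s ''A''" "narr u ''p'' 0 = p" using s agree_narr[OF a] by auto
    then show ?case using 7 by (intro runs_straight_line) (auto simp: I_def)
  qed (use s in \<open>auto simp: I_def\<close>)
  then have "runs Q copy_set s ((m * (1 + 2) + 2) + 1) (\<lambda>u. narr u ''p'' 0 = p + m \<and> I m u)"
    unfolding copy_set_def
  proof (rule runs_Seq, goal_cases)
    case (1 u)
    have "narr u ''p'' 0 = p" "narr u ''m'' 0 = m" using s agree_narr[OF 1(1)] by auto
    then show ?case using 1 by (intro runs_straight_line) (auto simp: I_def)
  qed
  then show ?thesis by (rule runs_weaken) (auto simp: I_def)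
qed

text \<open>The zeros of \<open>X\<close> past the written blocks are required by
  \<open>runs_output_singletons\<close>.\<close>

definition state_inv :: "(nat \<Rightarrow> nat set) \<Rightarrow> nat \<Rightarrow> store \<Rightarrow> bool" where
  "state_inv Ss t s \<longleftrightarrow>
     run_inv Ss t (rarr s ''P'') (rarr s ''R'') \<and> (\<forall>k<n. rarr s ''v'' k = weight Ss t k) \<and>
     members ''A'' s \<subseteq> {..<m} \<and> members ''B'' s \<subseteq> {..<m} \<and>
     narr s ''p'' 0 = t * m \<and> (\<forall>x\<ge>t * m. narr s ''X'' x = 0) \<and>
     (\<forall>\<tau><t. \<forall>j<m. narr s ''X'' (\<tau> * m + j) \<noteq> 0 \<longleftrightarrow> j \<in> Ss \<tau>) \<and>
     (\<forall>\<tau><t. rarr s ''w'' \<tau> = round_share)"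

lemma runs_play_round:
  assumes s: "narr s ''m'' 0 = m" "narr s ''n'' 0 = n" "narr s ''T'' 0 = rounds" "narr s ''t'' 0 = t"
    "rarr s ''c'' 0 = cap" and inv: "state_inv Ss t s"
  shows "runs Q (play_round N) s (12 * m * n + 24 * m + 7 * n + 13) (\<lambda>u. \<exists>Ss. state_inv Ss (Suc t) u)"
proof -
  have v: "\<And>k. k < n \<Longrightarrow> rarr s ''v'' k = weight Ss t k" and run: "run_inv Ss t (rarr s ''P'') (rarr s ''R'')"
    and AB: "members ''A'' s \<subseteq> {..<m}" "members ''B'' s \<subseteq> {..<m}"
    and p: "narr s ''p'' 0 = t * m"
    using inv by (auto simp: state_inv_def)
  have PR: "\<And>j. 0 \<le> rarr s ''P'' j \<and> 0 \<le> rarr s ''R'' j" and Ss: "\<And>\<tau>. \<tau> < t \<Longrightarrow> Ss \<tau> \<subseteq> {..<m}"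
    using run by (auto simp: run_inv_def)
  have "runs Q (play_round N) s
      ((12 * m * n + 21 * m + 3 * n + 7) + ((n * 4 + 2) + ((m * 3 + 3) + 1)))
      (\<lambda>u. \<exists>Ss. state_inv Ss (Suc t) u)"
    unfolding play_round_def
  proof (rule runs_Seq[OF runs_double_greedy[where v = "weight Ss t" and c = cap, folded objective_def]], goal_cases)
    case (11 s1)
    note a1 = this(1) and g = conjunct2[OF this(2)]
    define S where "S = members ''A'' s1"
    define Ss' where "Ss' = Ss(t := S)"
    have run': "run_inv Ss' (Suc t) (rarr s1 ''P'') (rarr s1 ''R'')"
      unfolding Ss'_def S_def by (rule run_inv_step[OF run g])
    have S: "S \<subseteq> {..<m}" using g by (simp add: greedy_inv_def S_def)
    have w': "weight Ss' t = weight Ss t" by (intro weight_cong) (simp add: Ss'_def)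
    show ?case
    proof (rule runs_Seq[OF runs_update_weights[where Ss = Ss' and t = t]], goal_cases)
      case (5 s2)
      note a2 = this(1)
      show ?case
      proof (rule runs_Seq[OF runs_copy_set[where p = "t * m"]], goal_cases)
        case (3 s3)
        note a3 = this(1)
        have A: "narr s2 ''A'' = narr s1 ''A''" "narr s2 ''X'' = narr s ''X''"
          using agree_narr[OF a2] agree_narr[OF a1] by auto
        have X: "narr s3 ''X'' x = (if t * m \<le> x \<and> x < t * m + m then narr s1 ''A'' (x - t * m)
            else narr s ''X'' x)" for x
          using 3(2) A by simp
        have X': "narr s3 ''X'' (\<tau> * m + j) \<noteq> 0 \<longleftrightarrow> j \<in> Ss' \<tau>" if "\<tau> < Suc t" "j < m" for \<tau> j
        proof (cases "\<tau> = t")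
          case True
          then show ?thesis using that by (simp add: X Ss'_def S_def members_def)
        next
          case False
          then have "\<tau> < t" using that by simp
          then show ?thesis
            using block_less[of \<tau> t j m] that inv by (simp add: X Ss'_def state_inv_def)
        qed
        have "rarr s3 ''P'' = rarr s1 ''P''" "rarr s3 ''R'' = rarr s1 ''R''" "rarr s3 ''v'' = rarr s2 ''v''"
          "rarr s3 ''w'' = rarr s ''w''" "narr s3 ''t'' 0 = t" "narr s3 ''m'' 0 = m" "narr s3 ''T'' 0 = rounds"
          "members ''A'' s3 = S" "members ''B'' s3 = members ''B'' s1"
          using agree_rarr[OF a3] agree_rarr[OF a2] agree_rarr[OF a1] agree_narr[OF a3] agree_narr[OF a2]
            agree_narr[OF a1] agree_members[OF a3] agree_members[OF a2] s by (auto simp: S_def)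
        moreover have "\<forall>x\<ge>Suc t * m. narr s3 ''X'' x = 0"
          using inv by (auto simp: X state_inv_def)
        moreover have "members ''B'' s1 = S" using 11(2) by (simp add: S_def)
        ultimately have "state_inv Ss' (Suc t) (rupd ''w'' t round_share s3)"
          "den Q (RAssign ''w'' (NVar ''t'') (round_weight N)) s3 = rupd ''w'' t round_share s3"
          using run' S X' 3(2) 5(2) inv
          by (auto simp: state_inv_def less_Suc_eq round_weight_def round_share_def Let_def add.commute)
        then show ?case by (intro runs_straight_line) auto
      qed (use s p agree_narr[OF a2] agree_narr[OF a1] in auto)
    qed (use s v w' agree_narr[OF a1] agree_rarr[OF a1] in \<open>auto simp: Ss'_def S_def\<close>)
  qed (use s v PR AB objective_props[OF Ss] in auto)
  then show ?thesis by (rule runs_weaken) (auto simp: algebra_simps)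
qed

section \<open>Approximation guarantee\<close>

text \<open>The invariant bounds the regret against every fixed set \<open>Z\<close>. Averaging over
  an optimal distribution \<open>q\<close> turns this into a bound against \<open>\<nu>\<close>,
  while each of the \<open>m\<close> deficits is at most the square root of 10 T.\<close>

lemma run_inv_regret:
  assumes inv: "run_inv Ss T P R"
    and q: "\<And>z. z \<in> C \<Longrightarrow> 0 \<le> q z" "sum q C = 1"
    and Z: "\<And>z. z \<in> C \<Longrightarrow> Z z \<subseteq> {..<m}"
    and \<nu>: "\<And>k. k < n \<Longrightarrow> \<nu> \<le> (\<Sum>z\<in>C. q z * G k (Z z))"
    and W: "\<And>t. 0 < (\<Sum>k<n. weight Ss t k)" and cap: "0 < cap"
  shows "2 * real T * (\<nu> / cap) - 4 * (\<Sum>t<T. objective Ss t (Ss t)) \<le> real m * sqrt (10 * real T)"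
proof -
  \<comment> \<open>Each function has expectation at least \<open>\<nu>\<close> under
    \<open>q\<close>, hence so has every weighted average of them; the same \<open>q\<close> serves
    all rounds.\<close>
  have avg: "\<nu> / cap \<le> (\<Sum>z\<in>C. q z * objective Ss t (Z z))" for t
  proof -
    let ?W = "\<Sum>k<n. weight Ss t k"
    have "?W * \<nu> \<le> (\<Sum>k<n. weight Ss t k * (\<Sum>z\<in>C. q z * G k (Z z)))"
      unfolding sum_distrib_right using \<nu> weight_nonneg inv
      by (intro sum_mono mult_left_mono) (auto simp: run_inv_def)
    also have "\<dots> = (\<Sum>z\<in>C. q z * (\<Sum>k<n. weight Ss t k * G k (Z z)))"
      unfolding sum_distrib_left by (subst sum.swap) (simp add: mult_ac)
    finally have "?W * \<nu> / (?W * cap) \<le> (\<Sum>z\<in>C. q z * (\<Sum>k<n. weight Ss t k * G k (Z z))) / (?W * cap)"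
      using W[of t] cap by (intro divide_right_mono) auto
    also have "\<dots> = (\<Sum>z\<in>C. q z * objective Ss t (Z z))"
      by (simp only: objective_def wavg_def times_divide_eq_right flip: sum_divide_distrib)
    finally show ?thesis using W[of t] by simp
  qed
  have PR: "P j \<le> sqrt (10 * real T)" "R j \<le> sqrt (10 * real T)" if "j < m" for j
  proof -
    have "(P j)\<^sup>2 + (R j)\<^sup>2 \<le> 10 * real T" using inv that by (simp add: run_inv_def)
    then show "P j \<le> sqrt (10 * real T)" "R j \<le> sqrt (10 * real T)"
      using zero_le_power2[of "P j"] zero_le_power2[of "R j"] by (intro real_le_rsqrt; linarith)+
  qed
  have "(\<Sum>t<T. 2 * objective Ss t (Z z) - 4 * objective Ss t (Ss t)) \<le> real m * sqrt (10 * real T)"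
    if "z \<in> C" for z
  proof -
    have "(\<Sum>t<T. 2 * objective Ss t (Z z) - 4 * objective Ss t (Ss t))
        \<le> (\<Sum>j<m. if j \<in> Z z then R j else P j)"
      using inv Z[OF that] by (simp add: run_inv_def)
    also have "\<dots> \<le> (\<Sum>j<m. sqrt (10 * real T))"
      using PR by (intro sum_mono) auto
    finally show ?thesis by simp
  qed
  then have bound: "(\<Sum>z\<in>C. q z * (\<Sum>t<T. 2 * objective Ss t (Z z) - 4 * objective Ss t (Ss t)))
      \<le> (\<Sum>z\<in>C. q z * (real m * sqrt (10 * real T)))"
    using q by (intro sum_mono mult_left_mono) auto
  have "(\<Sum>z\<in>C. q z * (\<Sum>t<T. 2 * objective Ss t (Z z) - 4 * objective Ss t (Ss t)))
      = (\<Sum>t<T. 2 * (\<Sum>z\<in>C. q z * objective Ss t (Z z)) - 4 * objective Ss t (Ss t))"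
  proof -
    have "(\<Sum>z\<in>C. q z * (\<Sum>t<T. 2 * objective Ss t (Z z) - 4 * objective Ss t (Ss t)))
        = (\<Sum>t<T. \<Sum>z\<in>C. q z * (2 * objective Ss t (Z z) - 4 * objective Ss t (Ss t)))"
      unfolding sum_distrib_left by (rule sum.swap)
    also have "\<dots> = (\<Sum>t<T. 2 * (\<Sum>z\<in>C. q z * objective Ss t (Z z)) - 4 * objective Ss t (Ss t))"
    proof (intro sum.cong refl)
      fix t
      have "(\<Sum>z\<in>C. q z * (2 * objective Ss t (Z z) - 4 * objective Ss t (Ss t)))
          = 2 * (\<Sum>z\<in>C. q z * objective Ss t (Z z)) - sum q C * (4 * objective Ss t (Ss t))"
        unfolding right_diff_distrib sum_subtractf sum_distrib_left sum_distrib_right by (simp add: mult_ac)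
      then show "(\<Sum>z\<in>C. q z * (2 * objective Ss t (Z z) - 4 * objective Ss t (Ss t)))
          = 2 * (\<Sum>z\<in>C. q z * objective Ss t (Z z)) - 4 * objective Ss t (Ss t)"
        by (simp add: q)
    qed
    finally show ?thesis .
  qed
  moreover have "(\<Sum>z\<in>C. q z * (real m * sqrt (10 * real T))) = real m * sqrt (10 * real T)"
    using q by (simp flip: sum_distrib_right)
  moreover have "(\<Sum>t<T. 2 * (\<nu> / cap) - 4 * objective Ss t (Ss t))
      \<le> (\<Sum>t<T. 2 * (\<Sum>z\<in>C. q z * objective Ss t (Z z)) - 4 * objective Ss t (Ss t))"
  proof (intro sum_mono)
    show "2 * (\<nu> / cap) - 4 * objective Ss t (Ss t)
        \<le> 2 * (\<Sum>z\<in>C. q z * objective Ss t (Z z)) - 4 * objective Ss t (Ss t)" for t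
      using avg[of t] by linarith
  qed
  ultimately have "(\<Sum>t<T. 2 * (\<nu> / cap) - 4 * objective Ss t (Ss t)) \<le> real m * sqrt (10 * real T)"
    using bound by linarith
  then show ?thesis by (simp add: sum_subtractf sum_distrib_left mult_ac)
qed

text \<open>Inactive functions drop out of numerator and denominator, which leaves the average gain
  of \<open>multiplicative_weights\<close> with \<open>\<eta>\<close> = 1 / N.\<close>

lemma objective_le_gain:
  assumes Ss: "\<And>t. Ss t \<subseteq> {..<m}" and k: "k < n" "active k"
  shows "(\<Sum>t<T. objective Ss t (Ss t)) \<le> (1 + 2 / real N) * (\<Sum>t<T. gain Ss k t) + real n * real N"
proof -
  define K where "K = {k. k < n \<and> active k}"
  define v where "v = (\<lambda>t k. \<Prod>\<tau><t. 1 - 1 / real N * gain Ss k \<tau>)"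
  have obj: "objective Ss t (Ss t) = (\<Sum>k\<in>K. v t k * gain Ss k t) / (\<Sum>k\<in>K. v t k)" for t
  proof -
    have "(\<Sum>k<n. weight Ss t k * G k (Ss t)) = (\<Sum>k\<in>K. v t k * G k (Ss t))"
      by (intro sum.mono_neutral_cong_right) (auto simp: K_def weight_def v_def)
    moreover have "(\<Sum>k<n. weight Ss t k) = (\<Sum>k\<in>K. v t k)"
      by (intro sum.mono_neutral_cong_right) (auto simp: K_def weight_def v_def)
    ultimately show ?thesis
      by (simp add: objective_def wavg_def gain_def mult.commute flip: sum_divide_distrib)
  qed
  have "(\<Sum>t<T. objective Ss t (Ss t))
      \<le> (1 + 2 * (1 / real N)) * (\<Sum>t<T. gain Ss k t) + real (card K) / (1 / real N)"
    unfolding obj v_def using k N_ge gain_bounds Ss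
    by (intro multiplicative_weights) (auto simp: K_def)
  moreover have "real (card K) / (1 / real N) \<le> real n * real N"
  proof -
    have "card K \<le> n"
      using card_mono[of "{..<n}" K] by (auto simp: K_def)
    then show ?thesis by (simp add: mult_right_mono)
  qed
  ultimately show ?thesis
    by simp
qed

text \<open>Both error terms are small against T \<nu>, where \<open>\<nu>\<close> is the optimum
  divided by \<open>cap\<close>. The first, squared, needs T of order N^2 m^2 / \<nu>^2, at most N^4
  m^6; the second needs n N^2 / \<nu>, at most N^3 m^2 n.\<close>

lemma rounds_large:
  assumes m: "m \<ge> 1" and \<nu>: "1 \<le> real N * (real m)\<^sup>2 * \<nu>"
  shows "real m * sqrt (10 * real rounds) \<le> 4 * real rounds * \<nu> / real N"
    and "real n * real N \<le> real rounds * \<nu> / real N"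
proof -
  have "0 < real N * (real m)\<^sup>2" using m N_ge by simp
  then have \<nu>0: "0 < \<nu>" using \<nu> by (smt (verit) mult_nonneg_nonpos)
  have le: "real N ^ 4 * real m ^ 6 \<le> real rounds" "real N ^ 3 * (real m)\<^sup>2 * real n \<le> real rounds"
  proof -
    have r: "real rounds = real N ^ 4 * (real m + 1) ^ 6 * real n" by (simp add: rounds_def add.commute)
    have "real m ^ 6 * 1 \<le> (real m + 1) ^ 6 * real n"
      using n_pos by (intro mult_mono power_mono) auto
    then show "real N ^ 4 * real m ^ 6 \<le> real rounds"
      by (simp add: r mult.assoc mult_left_mono)
    have "(real m)\<^sup>2 \<le> (real m + 1)\<^sup>2" by (intro power_mono) auto
    also have "\<dots> \<le> (real m + 1) ^ 6" by (intro power_increasing) auto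
    finally have "real N ^ 3 * (real m)\<^sup>2 * real n \<le> real N ^ 4 * (real m + 1) ^ 6 * real n"
      using N_ge by (intro mult_mono mult_right_mono power_increasing) auto
    then show "real N ^ 3 * (real m)\<^sup>2 * real n \<le> real rounds" by (simp add: r)
  qed
  have N0: "0 < real N" using N_ge by simp
  have "real n * real N * real N * 1 \<le> real n * real N * real N * (real N * (real m)\<^sup>2 * \<nu>)"
    using \<nu> by (intro mult_left_mono) auto
  also have "\<dots> = (real N ^ 3 * (real m)\<^sup>2 * real n) * \<nu>" by (simp add: power3_eq_cube mult_ac)
  also have "\<dots> \<le> real rounds * \<nu>" using le(2) \<nu>0 by (intro mult_right_mono) auto
  finally show "real n * real N \<le> real rounds * \<nu> / real N"
    using N0 by (simp add: pos_le_divide_eq)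
  have "(real m * sqrt (10 * real rounds))\<^sup>2 = 10 * ((real m)\<^sup>2 * real rounds * 1)"
    by (simp add: power_mult_distrib)
  also have "\<dots> \<le> 10 * ((real m)\<^sup>2 * real rounds * (real N * (real m)\<^sup>2 * \<nu>)\<^sup>2)"
    using \<nu> by (intro mult_left_mono) (auto simp: one_le_power)
  also have "\<dots> = 10 * (real rounds * \<nu>\<^sup>2 / (real N)\<^sup>2) * (real N ^ 4 * real m ^ 6)"
    using N0 by (simp add: field_simps power2_eq_square power_numeral_reduce)
  also have "\<dots> \<le> 10 * (real rounds * \<nu>\<^sup>2 / (real N)\<^sup>2) * real rounds"
    using le(1) by (intro mult_left_mono) auto
  also have "\<dots> \<le> 16 * (real rounds * \<nu>\<^sup>2 / (real N)\<^sup>2) * real rounds"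
    by (intro mult_right_mono) auto
  also have "\<dots> = (4 * real rounds * \<nu> / real N)\<^sup>2"
    by (simp add: field_simps power2_eq_square)
  finally show "real m * sqrt (10 * real rounds) \<le> 4 * real rounds * \<nu> / real N"
    by (rule power2_le_imp_le) (use \<nu>0 in simp)
qed

text \<open>For an inactive function the singletons alone reach half of the optimum; for an active
  one the sets of the rounds suffice. The part left out is nonnegative.\<close>

lemma run_guarantee:
  assumes inv: "run_inv Ss rounds P R"
    and q: "\<And>z. z \<in> C \<Longrightarrow> 0 \<le> q z" "sum q C = 1"
    and Z: "\<And>z. z \<in> C \<Longrightarrow> Z z \<subseteq> {..<m}"
    and \<nu>: "\<And>k. k < n \<Longrightarrow> \<nu> \<le> (\<Sum>z\<in>C. q z * G k (Z z))"
    and \<nu>0: "0 \<le> \<nu>" and \<nu>m: "Min (singleton_sum ` {..<n}) \<le> real m * \<nu>"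
    and \<epsilon>: "0 < \<epsilon>" "4 \<le> real N * \<epsilon>" and k: "k < n"
  shows "(1/2 - \<epsilon>) * \<nu> \<le> round_share * (\<Sum>t<rounds. G k (Ss t)) + singleton_share * singleton_sum k"
    (is "_ \<le> ?value")
proof -
  have Ss: "Ss t \<subseteq> {..<m}" for t using inv by (simp add: run_inv_def)
  have parts: "0 \<le> round_share * (\<Sum>t<rounds. G k (Ss t))" "0 \<le> singleton_share * singleton_sum k"
    using nonneg[OF k Ss] singleton_sum_nonneg[OF k]
    by (auto simp: round_share_def singleton_share_def intro!: mult_nonneg_nonneg divide_nonneg_nonneg sum_nonneg
        simp del: times_divide_eq_left)
  show ?thesis
  proof (cases "\<nu> = 0 \<or> \<epsilon> > 1/2")
    case True
    then have "(1/2 - \<epsilon>) * \<nu> \<le> 0" using \<nu>0 by (auto simp: mult_nonpos_nonneg)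
    then show ?thesis using parts by linarith
  next
    case False
    then have pos: "0 < \<nu>" and \<epsilon>': "\<epsilon> \<le> 1/2" using \<nu>0 by auto
    define \<mu> where "\<mu> = Min (singleton_sum ` {..<n})"
    have \<nu>_le: "\<nu> \<le> singleton_sum j" if "j < n" for j
    proof -
      have "(\<Sum>z\<in>C. q z * G j (Z z)) \<le> (\<Sum>z\<in>C. q z * singleton_sum j)"
        using q Z G_le[OF that] by (intro sum_mono mult_left_mono) auto
      then show ?thesis using \<nu>[OF that] q by (simp flip: sum_distrib_right)
    qed
    have "\<mu> \<in> singleton_sum ` {..<n}"
      unfolding \<mu>_def using n_pos by (intro Min_in) (auto simp: lessThan_empty_iff)
    then obtain k0 where k0: "k0 < n" "singleton_sum k0 = \<mu>" by auto
    have \<mu>: "\<nu> \<le> \<mu>" using \<nu>_le[OF k0(1)] k0 by simp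
    have m: "m \<ge> 1"
    proof (rule ccontr)
      assume "\<not> m \<ge> 1"
      then have "m = 0" by simp
      then have "singleton_sum k0 = 0" by (subst singleton_sum_def) simp
      then show False using \<mu> pos k0(2) by linarith
    qed
    have cap_eq: "cap = real N * real m * \<mu>" by (simp add: cap_def \<mu>_def)
    have Nm: "real N * real m \<ge> 1 + real m"
    proof -
      have "2 * real m \<le> real N * real m" using N_ge by (intro mult_right_mono) auto
      moreover have "1 \<le> real m" using m by simp
      ultimately show ?thesis by linarith
    qed
    have cap: "0 < cap" using N_ge m \<mu> pos by (simp add: cap_eq)
    show ?thesis
    proof (cases "active k")
      case False
      \<comment> \<open>An inactive function has singleton sum above N m \<mu>, and the singleton
        share is at least 1 / (2 N m) because 1 + m is at most N m.\<close>
      have "(1/2 - \<epsilon>) * \<nu> \<le> 1/2 * \<nu>" using pos \<epsilon> by (intro mult_right_mono) auto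
      also have "\<dots> \<le> 1/2 * \<mu>" using \<mu> by simp
      also have "\<dots> \<le> singleton_share * (real N * real m * \<mu>)"
      proof -
        have "(real N * real m + 1 + real m) * \<mu> \<le> 2 * (real N * real m) * \<mu>"
          using Nm \<mu> pos by (intro mult_right_mono) auto
        then show ?thesis using Nm by (simp add: singleton_share_def field_simps)
      qed
      also have "\<dots> \<le> singleton_share * singleton_sum k"
        using False by (intro mult_left_mono) (auto simp: active_def cap_eq singleton_share_def)
      finally show ?thesis using parts by linarith
    next
      case True
      define x where "x = 1 / real N"
      define H where "H = (\<Sum>t<rounds. gain Ss k t)"
      let ?T = "real rounds" and ?\<nu> = "\<nu> / cap"
      have N0: "0 < real N" using N_ge by simp
      have x: "0 < x" "4 * x \<le> \<epsilon>" using N0 \<epsilon> by (auto simp: x_def field_simps)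
      have T0: "0 < ?T" using N_ge n_pos by (simp add: rounds_def)
      \<comment> \<open>The function with the smallest singleton sum is active. Its weight stays
        positive, as gains are at most 1 and \<open>N\<close> is at least 2, so the total weight is
        positive in every round.\<close>
      have "\<mu> \<le> real N * real m * \<mu>"
        using Nm \<mu> pos by (simp add: mult_le_cancel_right1)
      then have act0: "active k0" by (simp add: active_def k0 cap_eq)
      have W: "0 < (\<Sum>k<n. weight Ss t k)" for t
      proof -
        have "0 < 1 - 1 / real N * gain Ss k0 \<tau>" for \<tau>
          using gain_bounds[of k0 Ss \<tau>] k0 act0 Ss N_ge by (simp add: divide_less_eq)
        then have "0 < weight Ss t k0" using act0 by (auto simp: weight_def intro!: prod_pos)
        also have "\<dots> \<le> (\<Sum>k<n. weight Ss t k)"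
          using k0 weight_nonneg Ss by (intro member_le_sum) auto
        finally show ?thesis .
      qed
      \<comment> \<open>The uniform distribution on singletons enters through \<open>\<nu>m\<close>:
        it keeps \<open>\<nu> / cap\<close> polynomially far from 0.\<close>
      have "cap \<le> real N * real m * (real m * \<nu>)"
        unfolding cap_eq using \<nu>m by (intro mult_left_mono) (auto simp: \<mu>_def)
      then have "1 \<le> real N * (real m)\<^sup>2 * ?\<nu>"
        using cap by (simp add: field_simps power2_eq_square)
      note large = rounds_large[OF m this]
      define U where "U = ?T * ?\<nu>"
      have U0: "0 \<le> U" using pos cap by (simp add: U_def)
      \<comment> \<open>From here on all errors are measured against \<open>U\<close>, the optimal
        scaled gain summed over the rounds.\<close>
      have "2 * U - 4 * (\<Sum>t<rounds. objective Ss t (Ss t)) \<le> 4 * U * x"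
        using run_inv_regret[OF inv q Z \<nu> W cap] large(1) by (simp add: x_def U_def)
      moreover have "(\<Sum>t<rounds. objective Ss t (Ss t)) \<le> (1 + 2 * x) * H + U * x"
        using objective_le_gain[where Ss = Ss and T = rounds, OF Ss k True] large(2) by (simp add: x_def H_def U_def)
      ultimately have "U * (1/2 - 2 * x) \<le> (1 + 2 * x) * H"
        by (simp add: algebra_simps)
      moreover have "U * ((1/2 - \<epsilon>) * (1 + x) * (1 + 2 * x)) \<le> U * (1/2 - 2 * x)"
        using ratio_bound[of x \<epsilon>] x \<epsilon>' U0 by (intro mult_left_mono) auto
      ultimately have "(1 + 2 * x) * (U * ((1/2 - \<epsilon>) * (1 + x))) \<le> (1 + 2 * x) * H"
        by (simp add: mult_ac)
      then have "U * ((1/2 - \<epsilon>) * (1 + x)) \<le> H"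
        using x by (subst (asm) mult_le_cancel_left_pos) auto
      then have "?T * (1 + x) * ((1/2 - \<epsilon>) * \<nu>) \<le> cap * H"
        using cap by (simp add: U_def field_simps)
      also have "cap * H = (\<Sum>t<rounds. G k (Ss t))"
        using cap by (simp add: H_def gain_def sum_distrib_left)
      finally have S: "(1/2 - \<epsilon>) * \<nu> \<le> (\<Sum>t<rounds. G k (Ss t)) / (?T * (1 + x))"
        using T0 x by (simp add: pos_le_divide_eq mult_ac)
      have "1 / (?T * (1 + x)) \<le> round_share"
      proof -
        \<comment> \<open>Mixing divides the weight of the rounds by 1 + m / (N m + 1), which is at
          most \<open>1 + x\<close>.\<close>
        have "real N * real m + 1 + real m \<le> (real N * real m + 1) * (1 + x)"
          using N0 by (simp add: x_def field_simps)
        moreover have "0 \<le> real N * real m" by simp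
        then have "0 < real N * real m + 1 + real m" by linarith
        ultimately show ?thesis
          using T0 x by (simp add: round_share_def divide_le_eq pos_le_divide_eq mult_ac)
      qed
      then have "1 / (?T * (1 + x)) * (\<Sum>t<rounds. G k (Ss t)) \<le> round_share * (\<Sum>t<rounds. G k (Ss t))"
        using nonneg[OF k Ss] by (intro mult_right_mono sum_nonneg) auto
      then show ?thesis using S parts by simp
    qed
  qed
qed

section \<open>The whole run\<close>

lemma runs_rounds:
  assumes s: "narr s ''m'' 0 = m" "narr s ''n'' 0 = n" "narr s ''T'' 0 = rounds" "rarr s ''c'' 0 = cap"
    and inv: "\<exists>Ss. state_inv Ss 0 s"
  shows "runs Q (For ''t'' ''T'' (play_round N)) s (rounds * (12 * m * n + 24 * m + 7 * n + 15) + 2)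
    (\<lambda>u. \<exists>Ss. state_inv Ss rounds u)"
proof -
  define I where "I = (\<lambda>j u. \<exists>Ss. state_inv Ss j u)"
  have "runs Q (For ''t'' ''T'' (play_round N)) s (rounds * ((12 * m * n + 24 * m + 7 * n + 13) + 2) + 2) (I rounds)"
  proof (rule runs_For, goal_cases)
    case (7 t u)
    note a = this(2)
    have "narr u ''m'' 0 = m" "narr u ''n'' 0 = n" "narr u ''T'' 0 = rounds" "rarr u ''c'' 0 = cap"
      using s agree_narr[OF a] agree_rarr[OF a] by auto
    moreover obtain Ss where "state_inv Ss t u" using 7(4) by (auto simp: I_def)
    ultimately show ?case unfolding I_def using 7(3) by (intro runs_play_round)
  qed (use s inv in \<open>auto simp: I_def state_inv_def\<close>)
  then show ?thesis by (rule runs_weaken) (auto simp: I_def)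
qed

lemma runs_output_singletons:
  assumes s: "narr s ''m'' 0 = m" "narr s ''T'' 0 = rounds" "narr s ''p'' 0 = rounds * m"
    "\<And>x. x \<ge> rounds * m \<Longrightarrow> narr s ''X'' x = 0"
  shows "runs Q (output_singletons N) s (m * 5 + 3)
    (\<lambda>u. narr u ''S'' 0 = rounds + m \<and>
      (\<forall>x<rounds * m. narr u ''X'' x = narr s ''X'' x) \<and>
      (\<forall>i<m. \<forall>j<m. narr u ''X'' ((rounds + i) * m + j) \<noteq> 0 \<longleftrightarrow> j = i) \<and>
      (\<forall>r<rounds. rarr u ''w'' r = rarr s ''w'' r) \<and>
      (\<forall>i<m. rarr u ''w'' (rounds + i) = singleton_share))"
proof -
  let ?c = "NAssign ''X'' (NAdd (NVar ''p'') (NVar ''i'')) (NConst 1) ;;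
        NAssign ''p'' (NConst 0) (NAdd (NVar ''p'') (NVar ''m'')) ;;
        RAssign ''w'' (NAdd (NVar ''T'') (NVar ''i'')) (singleton_weight N)"
  define I where "I = (\<lambda>i (u::store). narr u ''p'' 0 = (rounds + i) * m \<and>
      (\<forall>x\<ge>(rounds + i) * m. narr u ''X'' x = 0) \<and>
      (\<forall>x<rounds * m. narr u ''X'' x = narr s ''X'' x) \<and>
      (\<forall>i'<i. \<forall>j<m. narr u ''X'' ((rounds + i') * m + j) \<noteq> 0 \<longleftrightarrow> j = i') \<and>
      (\<forall>r<rounds. rarr u ''w'' r = rarr s ''w'' r) \<and>
      (\<forall>i'<i. rarr u ''w'' (rounds + i') = singleton_share))"
  have "runs Q (For ''i'' ''m'' ?c) s (m * (3 + 2) + 2) (I m)"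
  proof (rule runs_For, goal_cases)
    case (7 i u)
    note a = this(2) and i = this(1,3) and I = this(4)
    have u: "narr u ''m'' 0 = m" "narr u ''T'' 0 = rounds" using s agree_narr[OF a] by auto
    let ?p = "(rounds + i) * m"
    define u' where "u' = rupd ''w'' (rounds + i) singleton_share (nupd ''p'' 0 (?p + m) (nupd ''X'' (?p + i) 1 u))"
    have d: "den Q ?c u = u'"
      using I i u by (simp add: u'_def I_def singleton_weight_def singleton_share_def)
    have "narr u' ''X'' ((rounds + i') * m + j) \<noteq> 0 \<longleftrightarrow> j = i'" if "i' < Suc i" "j < m" for i' j
    proof (cases "i' = i")
      case True
      then show ?thesis using I by (simp add: u'_def I_def)
    next
      case False
      then have "rounds + i' < rounds + i" using that by simp
      from block_less[OF this that(2)] show ?thesis using False that I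
        by (simp add: u'_def I_def less_Suc_eq)
    qed
    moreover have "narr u' ''X'' x = narr s ''X'' x" if "x < rounds * m" for x
    proof -
      have "x < ?p + i" using that by (simp add: add_mult_distrib)
      then show ?thesis using that I by (simp add: u'_def I_def)
    qed
    moreover have "narr u' ''X'' x = 0" if "x \<ge> ?p + m" for x
      using that I i by (simp add: u'_def I_def)
    moreover have "?p + m = (rounds + Suc i) * m" by simp
    moreover have "narr u' ''p'' 0 = ?p + m" by (simp add: u'_def)
    moreover have "rarr u' ''w'' r = rarr s ''w'' r" if "r < rounds" for r
      using that I by (simp add: u'_def I_def)
    moreover have "rarr u' ''w'' (rounds + i') = singleton_share" if "i' < Suc i" for i'
      using that I by (auto simp: u'_def I_def less_Suc_eq)
    ultimately have "I (Suc i) u'"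
      unfolding I_def by simp
    then show ?case using d by (intro runs_straight_line) auto
  qed (use s in \<open>auto simp: I_def\<close>)
  then have "runs Q (output_singletons N) s ((m * (3 + 2) + 2) + 1) (\<lambda>u. narr u ''S'' 0 = rounds + m \<and> I m u)"
    unfolding output_singletons_def
  proof (rule runs_Seq, goal_cases)
    case (1 u)
    have "narr u ''T'' 0 = rounds" "narr u ''m'' 0 = m" using s agree_narr[OF 1(1)] by auto
    then show ?case using 1 by (intro runs_straight_line) (auto simp: I_def)
  qed
  then show ?thesis by (rule runs_weaken) (auto simp: I_def)
qed

definition run_cost :: nat where
  "run_cost = (n * (m * 6 + 6) + 2) + ((n * 4 + 3) + ((rounds * 2 + 1) +
     ((rounds * (12 * m * n + 24 * m + 7 * n + 15) + 2) + (m * 5 + 3))))"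

lemma runs_robust_program:
  "runs Q (robust_program N) (input_store m n) run_cost
    (\<lambda>u. \<exists>Ss P R. run_inv Ss rounds P R \<and> narr u ''S'' 0 = rounds + m \<and>
      (\<forall>r<rounds. \<forall>j<m. narr u ''X'' (r * m + j) \<noteq> 0 \<longleftrightarrow> j \<in> Ss r) \<and>
      (\<forall>i<m. \<forall>j<m. narr u ''X'' ((rounds + i) * m + j) \<noteq> 0 \<longleftrightarrow> j = i) \<and>
      (\<forall>r<rounds. rarr u ''w'' r = round_share) \<and>
      (\<forall>i<m. rarr u ''w'' (rounds + i) = singleton_share))"
  unfolding robust_program_def run_cost_def
proof (rule runs_Seq[OF runs_min_singleton_sums], goal_cases)
  case (6 s1)
  note a1 = this(1)
  show ?case
  proof (rule runs_Seq[OF runs_init_weights], goal_cases)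
    case (5 s2)
    note a2 = this(1)
    show ?case
    proof (rule runs_Seq[OF runs_compute_rounds], goal_cases)
      case (4 s3)
      note a3 = this(1)
      have e: "narr s3 a = narr (input_store m n) a" if "a \<notin> {''k'', ''i'', ''D'', ''T''}" for a
        using agree_narr[OF a3, of a] agree_narr[OF a2, of a] agree_narr[OF a1, of a] that by simp
      have "rarr s3 ''P'' = (\<lambda>_. 0)" "rarr s3 ''R'' = (\<lambda>_. 0)" "rarr s3 ''v'' = rarr s2 ''v''" "rarr s3 ''c'' 0 = cap"
        using agree_rarr[OF a3] agree_rarr[OF a2] agree_rarr[OF a1] 5(2)
        by (auto simp: input_store_def nupd_def)
      \<comment> \<open>The weights of round 0 are empty products and the deficits start at 0; the
        sequence of sets is a placeholder that the rounds overwrite.\<close>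
      then have "state_inv (\<lambda>_. {}) 0 s3"
        using 5(2) e[of "''A''"] e[of "''B''"] e[of "''p''"] e[of "''X''"]
        by (auto simp: state_inv_def run_inv_def weight_def members_def input_store_def)
      then have inv: "\<exists>Ss. state_inv Ss 0 s3" by blast
      have mn: "narr s3 ''m'' 0 = m" "narr s3 ''n'' 0 = n"
        using e[of "''m''"] e[of "''n''"] by (auto simp: input_store_def)
      show ?case
      proof (rule runs_Seq[OF runs_rounds], goal_cases)
        case (6 s4)
        then obtain Ss where inv: "state_inv Ss rounds s4" by blast
        have "narr s4 ''m'' 0 = m" "narr s4 ''T'' 0 = rounds"
          using agree_narr[OF 6(1)] mn 4 by auto
        with inv have "runs Q (output_singletons N) s4 (m * 5 + 3)
          (\<lambda>u. narr u ''S'' 0 = rounds + m \<and>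
            (\<forall>x<rounds * m. narr u ''X'' x = narr s4 ''X'' x) \<and>
            (\<forall>i<m. \<forall>j<m. narr u ''X'' ((rounds + i) * m + j) \<noteq> 0 \<longleftrightarrow> j = i) \<and>
            (\<forall>r<rounds. rarr u ''w'' r = rarr s4 ''w'' r) \<and>
            (\<forall>i<m. rarr u ''w'' (rounds + i) = singleton_share))"
          by (intro runs_output_singletons) (auto simp: state_inv_def)
        then show ?case
        proof (rule runs_weaken, goal_cases)
          case (2 u)
          \<comment> \<open>The singletons are written past \<open>rounds * m\<close>, so the
            earlier blocks are intact.\<close>
          then have "\<forall>r<rounds. \<forall>j<m. narr u ''X'' (r * m + j) \<noteq> 0 \<longleftrightarrow> j \<in> Ss r"
            using inv block_less[of _ rounds _ m] by (simp add: state_inv_def)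
          then show ?case using 2 inv by (auto simp: state_inv_def)
        qed simp
      qed (use mn 4 inv \<open>rarr s3 ''c'' 0 = cap\<close> in auto)
    qed (use agree_narr[OF a1] agree_narr[OF a2] in \<open>auto simp: input_store_def\<close>)
  qed (use 6(2) agree_narr[OF a1] in \<open>auto simp: input_store_def\<close>)
qed (use n_pos in \<open>auto simp: input_store_def members_def\<close>)

text \<open>With z = m + n + 1 there are at most N^4 z^7 rounds, each of cost quadratic in z. For
  fixed \<open>N\<close> the factor N^4 is a coefficient of the polynomial.\<close>

lemma run_cost_le:
  "run_cost \<le> poly ([:11:] * [:1, 1:] ^ 2 + [:N ^ 4:] * [:1, 1:] ^ 7 * ([:2:] + [:24:] * [:1, 1:] ^ 2)) (m + n)"
proof -
  define z where "z = 1 + (m + n)"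
  define b where "b = 12 * m * n + 24 * m + 7 * n + 15"
  have "rounds \<le> N ^ 4 * (z ^ 6 * z)"
    unfolding rounds_def mult.assoc z_def by (intro mult_le_mono power_mono) auto
  moreover have "x ^ 7 = x ^ 6 * x" for x :: nat by (simp add: power_numeral_reduce)
  ultimately have "rounds \<le> N ^ 4 * z ^ 7" by simp
  moreover have "2 + b \<le> 2 + 24 * z ^ 2"
    by (simp add: b_def z_def power2_eq_square algebra_simps)
  ultimately have "rounds * (2 + b) \<le> N ^ 4 * z ^ 7 * (2 + 24 * z ^ 2)"
    by (rule mult_le_mono)
  moreover have "rounds * (2 + b) = rounds * 2 + rounds * b" by (rule distrib_left)
  moreover have "(n * (m * 6 + 6) + 2) + (n * 4 + 3) + 1 + 2 + (m * 5 + 3) \<le> 11 * z ^ 2"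
    by (simp add: z_def power2_eq_square algebra_simps)
  ultimately have "run_cost \<le> 11 * z ^ 2 + N ^ 4 * z ^ 7 * (2 + 24 * z ^ 2)"
    unfolding run_cost_def b_def[symmetric] by linarith
  then show ?thesis by (simp add: z_def distrib_left mult_ac)
qed

lemma shares_sum: "real rounds * round_share + real m * singleton_share = 1"
proof -
  let ?h = "real N * real m + 1"
  have "real rounds \<noteq> 0" using N_ge n_pos by (simp add: rounds_def)
  moreover have "?h + real m > 0" by (simp add: add_nonneg_pos add_pos_nonneg)
  ultimately show ?thesis
    by (simp add: round_share_def singleton_share_def add_divide_distrib[symmetric])
qed

lemma shares_nonneg: "0 \<le> round_share" "0 \<le> singleton_share"
  by (simp_all add: round_share_def singleton_share_def)

end

section \<open>Output distributions and sets of positions\<close>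

text \<open>Listed sets may coincide, so a probability collects the weights of a fibre of
  \<open>Y\<close>; expectations can nevertheless be computed along the list.\<close>

lemma pmf_of_weighted_family:
  fixes w :: "nat \<Rightarrow> real" and Y :: "nat \<Rightarrow> 'a set"
  assumes w: "\<And>r. r < S \<Longrightarrow> 0 \<le> w r" "(\<Sum>r<S. w r) = 1"
    and Y: "\<And>r. r < S \<Longrightarrow> Y r \<subseteq> E" and E: "finite E"
  shows "\<exists>p\<in>Delta (Pow E). (\<forall>Z. pmf p Z = (\<Sum>r | r < S \<and> Y r = Z. w r)) \<and>
    (\<forall>g. (\<Sum>Z\<in>Pow E. pmf p Z * g Z) = (\<Sum>r<S. w r * g (Y r)))"
proof -
  define q where "q Z = (\<Sum>r | r < S \<and> Y r = Z. w r)" for Z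
  have q0: "0 \<le> q Z" for Z unfolding q_def using w by (intro sum_nonneg) auto
  have qE: "q Z = 0" if "Z \<notin> Pow E" for Z
    unfolding q_def using that Y by (intro sum.neutral) auto
  have qg: "(\<Sum>Z\<in>Pow E. q Z * g Z) = (\<Sum>r<S. w r * g (Y r))" for g
  proof -
    have "(\<Sum>r<S. w r * g (Y r)) = (\<Sum>Z\<in>Pow E. \<Sum>r\<in>{r \<in> {..<S}. Y r = Z}. w r * g (Y r))"
      using E Y by (intro sum.group[symmetric]) auto
    also have "\<dots> = (\<Sum>Z\<in>Pow E. q Z * g Z)"
      unfolding q_def sum_distrib_right by (intro sum.cong) auto
    finally show ?thesis by simp
  qed
  have "(\<integral>\<^sup>+ Z. ennreal (q Z) \<partial>count_space UNIV) = (\<Sum>Z\<in>Pow E. ennreal (q Z))"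
    using E qE by (intro nn_integral_count_space') auto
  also have "\<dots> = 1"
    using q0 qg[of "\<lambda>_. 1"] w by (simp add: sum_ennreal)
  finally have p: "pmf (embed_pmf q) = q"
    using q0 by (intro ext pmf_embed_pmf) auto
  show ?thesis
  proof (intro bexI conjI allI)
    show "embed_pmf q \<in> Delta (Pow E)"
      using qE by (auto simp: Delta_def set_pmf_eq p)
    show "pmf (embed_pmf q) Z = (\<Sum>r | r < S \<and> Y r = Z. w r)" for Z
      by (simp add: p q_def)
    show "(\<Sum>Z\<in>Pow E. pmf (embed_pmf q) Z * g Z) = (\<Sum>r<S. w r * g (Y r))" for g
      by (simp only: p qg)
  qed
qed

lemma sum_lessThan_add: "(\<Sum>r<a + b. h r) = (\<Sum>r<a. h r) + (\<Sum>i<b. h (a + i))"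
  for h :: "nat \<Rightarrow> 'a::comm_monoid_add" and a b :: nat
  by (induction b) (auto simp: add.assoc)

lemma subset_at_subset: "subset_at es J \<subseteq> set es"
  by (auto simp: subset_at_def)

lemma subset_at_cong: "(\<And>j. j < length es \<Longrightarrow> j \<in> J \<longleftrightarrow> j \<in> J') \<Longrightarrow> subset_at es J = subset_at es J'"
  by (auto simp: subset_at_def)

lemma subset_at_Un: "subset_at es (J \<union> J') = subset_at es J \<union> subset_at es J'"
  by (auto simp: subset_at_def)

lemma subset_at_Int: "distinct es \<Longrightarrow> subset_at es (J \<inter> J') = subset_at es J \<inter> subset_at es J'"
  by (auto simp: subset_at_def nth_eq_iff_index_eq)

lemma subset_at_surj: "X \<subseteq> set es \<Longrightarrow> subset_at es {j. j < length es \<and> es ! j \<in> X} = X"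
  by (fastforce simp: subset_at_def in_set_conv_nth)

theorem mainTheorem9:
  fixes \<epsilon> :: real
  assumes "\<epsilon> > 0"
  shows "\<exists>(c :: com) (T :: nat poly).
    \<forall>(E :: 'a set) (es :: 'a list) (n :: nat) (f :: nat \<Rightarrow> 'a set \<Rightarrow> real).
      finite E \<and> set es = E \<and> distinct es \<and> n \<ge> 1 \<and>
      (\<forall>k\<in>{1..n}. submodular_on E (f k) \<and> (\<forall>X\<subseteq>E. 0 \<le> f k X) \<and> f k {} = 0) \<longrightarrow>
      (\<exists>t s p.
        exec (value_oracle es n f) c (input_store (length es) n) t s \<and>
        t \<le> poly T (card E + n) \<and>
        outputs es s p \<and>
        p \<in> Delta (Pow E) \<and>
        (MIN k\<in>{1..n}. \<Sum>X\<in>Pow E. pmf p X * f k X) \<ge> (1/2 - \<epsilon>) * nu_star (Pow E) n f)"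
proof -
  \<comment> \<open>This gives 4 / N \<le> \<epsilon>, as \<open>ratio_bound\<close> needs for
    \<open>x\<close> = 1 / N, and \<open>N\<close> at least 2 keeps the learning rate 1 / N at most
    1/2.\<close>
  define N where "N = max 2 (nat \<lceil>4 / \<epsilon>\<rceil>)"
  have N2: "N \<ge> 2" by (simp add: N_def)
  have "4 / \<epsilon> \<le> real N" unfolding N_def by linarith
  then have N4: "4 \<le> real N * \<epsilon>" using assms by (simp add: divide_le_eq)
  define T where "T = [:11:] * [:1, 1:] ^ 2 + [:N ^ 4:] * [:1, 1:] ^ 7 * ([:2:] + [:24:] * [:1, 1:] ^ 2)"
  show ?thesis
  proof (rule exI[of _ "robust_program N"], rule exI[of _ T], intro allI impI, elim conjE)
    fix E :: "'a set" and es n and f :: "nat \<Rightarrow> 'a set \<Rightarrow> real"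
    assume E: "finite E" "set es = E" "distinct es" and n: "n \<ge> 1"
      and f: "\<forall>k\<in>{1..n}. submodular_on E (f k) \<and> (\<forall>X\<subseteq>E. 0 \<le> f k X) \<and> f k {} = 0"
    define m where "m = length es"
    have cE: "card E = m" using E distinct_card[of es] by (simp add: m_def)
    interpret machine_run "value_oracle es n f" m n N .
    have G: "G k Y = f (Suc k) (subset_at es Y)" if "k < n" for k Y
      using that by (simp add: G_def value_oracle_def)
    have G': "G (k - 1) Y = f k (subset_at es Y)" if "k \<in> {1..n}" for k Y
      using G[of "k - 1" Y] that by auto
    have fk: "submodular_on E (f (Suc k))" "\<And>X. X \<subseteq> E \<Longrightarrow> 0 \<le> f (Suc k) X" "f (Suc k) {} = 0" if "k < n" for k
      using f that by auto
    interpret robust_run "value_oracle es n f" m n N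
    proof unfold_locales
      fix k assume k: "k < n"
      show "submodular_on {..<m} (G k)"
        unfolding submodular_on_def using submodular_onD[OF fk(1)[OF k]] subset_at_subset[of es] E k
        by (simp add: G subset_at_Un subset_at_Int)
      show "G k {} = 0" using fk k by (simp add: G subset_at_def)
      show "0 \<le> G k Y" for Y using fk(2)[OF k, of "subset_at es Y"] subset_at_subset[of es Y] E k by (simp add: G)
    qed (use n N2 in auto)
    define \<nu> where "\<nu> = nu_star (Pow E) n f"
    obtain q where q: "q \<in> Delta (Pow E)" "robust_value (Pow E) n f q = \<nu>"
      and opt: "\<And>p. p \<in> Delta (Pow E) \<Longrightarrow> robust_value (Pow E) n f p \<le> \<nu>"
      using nu_star_attained[of "Pow E" n f] E n by (auto simp: \<nu>_def)
    \<comment> \<open>The optimum \<open>q\<close> lives on subsets of \<open>E\<close>; each subset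
      is replaced by its set of positions, the form in which \<open>run_guarantee\<close> takes its
      comparison sets.\<close>
    have \<nu>_le: "\<nu> \<le> (\<Sum>X\<in>Pow E. pmf q X * G k {j. j < m \<and> es ! j \<in> X})" if k: "k < n" for k
    proof -
      have "\<nu> \<le> (\<Sum>X\<in>Pow E. pmf q X * f (Suc k) X)"
        unfolding q(2)[symmetric] robust_value_def using k by (intro Min_le) auto
      also have "\<dots> = (\<Sum>X\<in>Pow E. pmf q X * G k {j. j < m \<and> es ! j \<in> X})"
        using E k by (intro sum.cong) (auto simp: G m_def subset_at_surj)
      finally show ?thesis .
    qed
    have sum_q: "sum (pmf q) (Pow E) = 1"
      using q E by (intro sum_pmf_eq_1) (auto simp: Delta_def)
    have \<nu>0: "0 \<le> \<nu>"
      unfolding q(2)[symmetric] robust_value_def using n f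
      by (subst Min_ge_iff) (auto intro!: sum_nonneg mult_nonneg_nonneg)
    have \<nu>m: "Min (singleton_sum ` {..<n}) \<le> real m * \<nu>"
    proof (cases "m = 0")
      case True
      have "Min (singleton_sum ` {..<n}) \<le> singleton_sum 0" using n by (intro Min_le) auto
      also have "\<dots> = 0" using True by (subst singleton_sum_def) simp
      finally show ?thesis using True by simp
    next
      case False
      \<comment> \<open>The uniform distribution on singletons, which gives each function its
        singleton sum divided by \<open>m\<close>.\<close>
      obtain p where p: "p \<in> Delta (Pow E)"
        "\<And>g. (\<Sum>Z\<in>Pow E. pmf p Z * g Z) = (\<Sum>r<m. 1 / real m * g (subset_at es {r}))"
        using pmf_of_weighted_family[of m "\<lambda>_. 1 / real m" "\<lambda>r. subset_at es {r}" E] False E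
          subset_at_subset[of es] by (simp del: times_divide_eq_left) blast
      have "Min (singleton_sum ` {..<n}) / real m \<le> robust_value (Pow E) n f p"
        unfolding robust_value_def
      proof (subst Min_ge_iff, goal_cases)
        case 3
        have "Min (singleton_sum ` {..<n}) / real m \<le> (\<Sum>X\<in>Pow E. pmf p X * f k X)" if k: "k \<in> {1..n}" for k
        proof -
          have "(\<Sum>X\<in>Pow E. pmf p X * f k X) = singleton_sum (k - 1) / real m"
            unfolding p(2) singleton_sum_def using G'[OF k] by (simp add: sum_divide_distrib)
          moreover have "Min (singleton_sum ` {..<n}) \<le> singleton_sum (k - 1)"
            using k by (intro Min_le) auto
          ultimately show ?thesis by (simp add: divide_right_mono)
        qed
        then show ?case by auto
      qed (use n in auto)
      then have "Min (singleton_sum ` {..<n}) / real m \<le> \<nu>" using opt[OF p(1)] by linarith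
      then show ?thesis using False by (simp add: divide_le_eq mult.commute)
    qed
    obtain t s Ss P R where exec: "exec (value_oracle es n f) (robust_program N) (input_store m n) t s"
      and t: "t \<le> run_cost" and inv: "run_inv Ss rounds P R" and S: "narr s ''S'' 0 = rounds + m"
      and X: "\<forall>r<rounds. \<forall>j<m. narr s ''X'' (r * m + j) \<noteq> 0 \<longleftrightarrow> j \<in> Ss r"
        "\<forall>i<m. \<forall>j<m. narr s ''X'' ((rounds + i) * m + j) \<noteq> 0 \<longleftrightarrow> j = i"
      and w: "\<forall>r<rounds. rarr s ''w'' r = round_share" "\<forall>i<m. rarr s ''w'' (rounds + i) = singleton_share"
      using runs_robust_program[unfolded runs_def] by (elim exE conjE) (rule that; assumption)
    note split = sum_lessThan_add[of _ rounds m]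
    have w0: "0 \<le> rarr s ''w'' r" if "r < rounds + m" for r
    proof (cases "r < rounds")
      case False
      then have "rarr s ''w'' (rounds + (r - rounds)) = singleton_share" using w that by (intro w(2)[rule_format]) linarith
      then show ?thesis using False shares_nonneg by simp
    qed (use w shares_nonneg in auto)
    have "(\<Sum>r<rounds + m. rarr s ''w'' r) = 1"
      unfolding split using w shares_sum by simp
    then obtain p where p: "p \<in> Delta (Pow E)"
      "\<And>Z. pmf p Z = (\<Sum>r | r < rounds + m \<and> output_set es s r = Z. rarr s ''w'' r)"
      "\<And>g. (\<Sum>Z\<in>Pow E. pmf p Z * g Z) = (\<Sum>r<rounds + m. rarr s ''w'' r * g (output_set es s r))"
      using pmf_of_weighted_family[of "rounds + m" "rarr s ''w''" "output_set es s" E] w0 E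
        subset_at_subset[of es] unfolding output_set_def by blast
    have out: "r < rounds \<Longrightarrow> output_set es s r = subset_at es (Ss r)"
      "i < m \<Longrightarrow> output_set es s (rounds + i) = subset_at es {i}" for r i
      unfolding output_set_def using X by (auto simp: m_def intro!: subset_at_cong)
    have approx: "(1/2 - \<epsilon>) * \<nu> \<le> (\<Sum>Z\<in>Pow E. pmf p Z * f k Z)" if k: "k \<in> {1..n}" for k
    proof -
      have "(\<Sum>Z\<in>Pow E. pmf p Z * f k Z)
          = (\<Sum>r<rounds. round_share * f k (subset_at es (Ss r))) + (\<Sum>i<m. singleton_share * f k (subset_at es {i}))"
        unfolding p(3) split using w out by simp
      also have "\<dots> = round_share * (\<Sum>t<rounds. G (k - 1) (Ss t)) + singleton_share * singleton_sum (k - 1)"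
        unfolding singleton_sum_def using G'[OF k] by (simp add: sum_distrib_left)
      finally have eq: "(\<Sum>Z\<in>Pow E. pmf p Z * f k Z)
          = round_share * (\<Sum>t<rounds. G (k - 1) (Ss t)) + singleton_share * singleton_sum (k - 1)" .
      have "k - 1 < n" using k by auto
      from run_guarantee[OF inv _ sum_q _ \<nu>_le \<nu>0 \<nu>m assms N4 this] show ?thesis
        unfolding eq by fastforce
    qed
    have "exec (value_oracle es n f) (robust_program N) (input_store (length es) n) t s"
      using exec by (simp add: m_def)
    moreover have "t \<le> poly T (card E + n)"
      using t run_cost_le unfolding T_def cE by (rule order_trans)
    moreover have "outputs es s p"
      unfolding outputs_def S using w0 p(2) by auto
    moreover have "(1/2 - \<epsilon>) * nu_star (Pow E) n f \<le> (MIN k\<in>{1..n}. \<Sum>X\<in>Pow E. pmf p X * f k X)"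
      unfolding \<nu>_def[symmetric] using n approx by (subst Min_ge_iff) auto
    ultimately show "\<exists>t s p.
        exec (value_oracle es n f) (robust_program N) (input_store (length es) n) t s \<and>
        t \<le> poly T (card E + n) \<and>
        outputs es s p \<and>
        p \<in> Delta (Pow E) \<and>
        (MIN k\<in>{1..n}. \<Sum>X\<in>Pow E. pmf p X * f k X) \<ge> (1/2 - \<epsilon>) * nu_star (Pow E) n f"
      using p(1) by blast
  qed
qed

end
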